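(* Let $\Delta$ be a triangular configuration and let $\Delta'$ be its matching reduction (defined in the context). For every even subconfiguration $C$ of $\Delta$ there exists exactly one perfect matching $M_C$ of $\Delta'$ such that, for every triangle $t$ of $\Delta$, the set of triangles of $M_C$ lying in the matching triangle of $t$ is $M_t^1$ if $t\in C$ and $M_t^0$ if $t\notin C$. Moreover, $\Delta'$ has no other perfect matchings, i.e. $C\mapsto M_C$ is a bijection from the set of even subconfigurations of $\Delta$ to the set of perfect matchings of $\Delta'$.
   Context: A triangular configuration is a finite $2$-dimensional simplicial complex in which every maximal simplex is a triangle (the empty complex is allowed); $E(\Delta)$ and $T(\Delta)$ are its sets of edges and triangles. An even subconfiguration (cycle) of $\Delta$ is a subcomplex $C$ that is a triangular configuration and in which every edge is incident with an even number of triangles of $C$; it is determined by its set of triangles, and the empty one is allowed. A matching of a triangular configuration is a set of its triangles no two of which share an edge; it is perfect if every edge of the configuration lies in exactly one triangle of the matching. An empty triangle consists of three vertices and the three edges joining them, without the $2$-simplex. Gadgets. $P$ is the boundary complex of the octahedron, with its $8$ triangles labelled $t_1^P,\dots,t_8^P$ so that the odd-labelled triangles are pairwise edge-disjoint and the even-labelled triangles are pairwise edge-disjoint. A tunnel between two vertex-disjoint triangles $\{1,2,3\}$ and $\{a,b,c\}$ consists of the six side triangles $\{1,2,c\},\{1,3,b\},\{2,3,a\},\{1,b,c\},\{2,a,c\},\{3,a,b\}$ (the octahedron boundary without two opposite faces); the triangles $\{1,2,3\}$ and $\{a,b,c\}$ are its ending triangles and are not among the side triangles. Matching edge: for two disjoint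 empty triangles $p,q$, the configuration $E_{pq}$ is obtained by taking a new copy of $P$, removing the triangles $t_1^P,t_3^P$ (keeping their edges), and adding a tunnel between $t_1^P$ and $p$ and a tunnel between $t_3^P$ and $q$; the triangles $p,q$ remain empty. Matching triangle: for three pairwise disjoint empty triangles $p,q,r$, the configuration $T_{pqr}$ is obtained by taking a new copy of $P$, removing the triangles $t_1^P,t_3^P,t_5^P$ (keeping their edges), and adding tunnels between $t_1^P$ and $p$, between $t_3^P$ and $q$, and between $t_5^P$ and $r$; $p,q,r$ remain empty. In $T_{pqr}$ let $M^1_{pqr}$ be the set consisting of $t_2^P,t_4^P,t_6^P,t_8^P$ and all side triangles of the three tunnels sharing an edge with $p$, $q$ or $r$ (it covers all edges of $T_{pqr}$), and let $M^0_{pqr}$ be the set consisting of $t_7^P$ and all side triangles of the three tunnels sharing an edge with $t_1^P$, $t_3^P$ or $t_5^P$ (it covers all edges except those of $p,q,r$). Configuration $C_{t_1\dots t_n}$ ($n\ge 1$): given pairwise disjoint empty triangles $t_1,\dots,t_n$, take new pairwise disjoint empty triangles $t_1',\dots,t_n'$, and add matching edges $E_{t_it_i'}$ for $1\le i\le n$, $E_{t_it_{i-1}'}$ for $2\le i\le n$, and $E_{t_i't_{i+1}'}$ for $1\le i\le n-1$, each using its own new copy of $P$. Matching reduction $\Delta'$ of $\Delta$: take pairwise disjoint empty triangles $t_e$, one for each pair $(t,e)$ with $t\in T(\Delta)$ and $e$ an edge of $t$. For every $t\in T(\Delta)$ with edges $a,b,c$ add a matching triangle $T_{t_at_bt_c}$,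 and write $M_t^1=M^1_{t_at_bt_c}$, $M_t^0=M^0_{t_at_bt_c}$. For every $e\in E(\Delta)$, with $t^1,\dots,t^n$ the triangles of $\Delta$ incident with $e$ (in some fixed order), add $C_{t^1_e\dots t^n_e}$. All gadgets are glued only along the empty triangles $t_e$. *)

theory Defs
  imports Main
begin

section \<open>Triangular configurations and matchings\<close>

text \<open>
  Complexes are abstract simplicial complexes, given as sets of nonempty finite simplices, so the
  empty complex is \<open>{}\<close>.
\<close>

definition simplicial_cpx :: "'v set set \<Rightarrow> bool" where
  "simplicial_cpx K \<longleftrightarrow>
     (\<forall>s\<in>K. finite s \<and> s \<noteq> {}) \<and> (\<forall>s\<in>K. \<forall>u. u \<noteq> {} \<and> u \<subseteq> s \<longrightarrow> u \<in> K)"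

definition maximal_simplex :: "'v set set \<Rightarrow> 'v set \<Rightarrow> bool" where
  "maximal_simplex K s \<longleftrightarrow> s \<in> K \<and> (\<forall>u\<in>K. s \<subseteq> u \<longrightarrow> u = s)"

definition triangular_configuration :: "'v set set \<Rightarrow> bool" where
  "triangular_configuration K \<longleftrightarrow>
     finite K \<and> simplicial_cpx K \<and> (\<forall>s. maximal_simplex K s \<longrightarrow> card s = 3)"

definition edges :: "'v set set \<Rightarrow> 'v set set" where
  "edges K = {s \<in> K. card s = 2}"

definition triangles :: "'v set set \<Rightarrow> 'v set set" where
  "triangles K = {s \<in> K. card s = 3}"

definition edges_of :: "'v set \<Rightarrow> 'v set set" where
  "edges_of t = {e. e \<subseteq> t \<and> card e = 2}"

definition share_edge :: "'v set \<Rightarrow> 'v set \<Rightarrow> bool" where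
  "share_edge s t \<longleftrightarrow> edges_of s \<inter> edges_of t \<noteq> {}"

definition even_subconfiguration :: "'v set set \<Rightarrow> 'v set set \<Rightarrow> bool" where
  "even_subconfiguration K C \<longleftrightarrow>
     C \<subseteq> K \<and> triangular_configuration C \<and>
     (\<forall>e\<in>edges C. even (card {t \<in> triangles C. e \<subseteq> t}))"

definition matching :: "'v set set \<Rightarrow> 'v set set \<Rightarrow> bool" where
  "matching K M \<longleftrightarrow> M \<subseteq> triangles K \<and> (\<forall>s\<in>M. \<forall>t\<in>M. s \<noteq> t \<longrightarrow> \<not> share_edge s t)"

definition perfect_matching :: "'v set set \<Rightarrow> 'v set set \<Rightarrow> bool" where
  "perfect_matching K M \<longleftrightarrow> matching K M \<and> (\<forall>e\<in>edges K. \<exists>!t. t \<in> M \<and> e \<subseteq> t)"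

definition generated_cpx :: "'v set set \<Rightarrow> 'v set set" where
  "generated_cpx S = {s. s \<noteq> {} \<and> (\<exists>t\<in>S. s \<subseteq> t)}"


section \<open>Gadgets\<close>

text \<open>Vertices of the octahedron; \<open>Xp\<close> is antipodal to \<open>Xm\<close>, and so on.\<close>

datatype oct = Xp | Xm | Yp | Ym | Zp | Zm

definition octahedron :: "oct set set" where
  "octahedron = generated_cpx {{x, y, z} |x y z. x \<in> {Xp, Xm} \<and> y \<in> {Yp, Ym} \<and> z \<in> {Zp, Zm}}"

text \<open>
  \<open>tP i\<close> is the triangle labelled \<open>i\<close>, for \<open>1 \<le> i \<le> 8\<close>. Every permutation of the four
  odd-labelled triangles is induced by an automorphism of the octahedron, and an antipodal map
  exchanges the odd- and even-labelled ones, so the choice of the odd-labelled triangles and of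
  their order does not matter; of the even-labelled ones only the set is used below.
\<close>

definition tP :: "nat \<Rightarrow> oct set" where
  "tP i = [{Xp, Yp, Zp}, {Xm, Ym, Zm}, {Xp, Ym, Zm}, {Xm, Yp, Zp},
           {Xm, Yp, Zm}, {Xp, Ym, Zp}, {Xm, Ym, Zp}, {Xp, Yp, Zm}] ! (i - 1)"

text \<open>
  The two ending triangles have vertices \<open>f x\<close> and \<open>g x\<close> for \<open>x\<close> in the three-element set \<open>I\<close>;
  \<open>f x\<close> and \<open>g x\<close> are the vertices not joined by an edge. For \<open>f\<close> with values \<open>1, 2, 3\<close> and
  \<open>g\<close> with values \<open>a, b, c\<close> the side triangles are \<open>{2,3,a}\<close>, \<open>{1,3,b}\<close>, \<open>{1,2,c}\<close> and
  \<open>{1,b,c}\<close>, \<open>{2,a,c}\<close>, \<open>{3,a,b}\<close>.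
\<close>

definition tunnel :: "'i set \<Rightarrow> ('i \<Rightarrow> 'v) \<Rightarrow> ('i \<Rightarrow> 'v) \<Rightarrow> 'v set set" where
  "tunnel I f g = (\<lambda>x. insert (g x) (f ` (I - {x}))) ` I \<union> (\<lambda>x. insert (f x) (g ` (I - {x}))) ` I"

text \<open>
  An empty triangle is given by an injective map \<open>p\<close> from \<open>corner\<close> to the vertices, a copy of the
  octahedron by an injective map \<open>\<iota>\<close>. The map \<open>\<tau> k\<close> from \<open>tP k\<close> onto \<open>corner\<close> selects one of
  the six tunnels between the copy of \<open>tP k\<close> and an empty triangle. The edges of both ending
  triangles belong to the complex generated by the side triangles.
\<close>

datatype corner = C1 | C2 | C3

abbreviation oct_tunnel ::
  "(oct \<Rightarrow> 'v) \<Rightarrow> (nat \<Rightarrow> oct \<Rightarrow> corner) \<Rightarrow> nat \<Rightarrow> (corner \<Rightarrow> 'v) \<Rightarrow> 'v set set" where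
  "oct_tunnel \<iota> \<tau> k p \<equiv> tunnel (tP k) \<iota> (p \<circ> \<tau> k)"

definition matching_edge ::
  "(oct \<Rightarrow> 'v) \<Rightarrow> (nat \<Rightarrow> oct \<Rightarrow> corner) \<Rightarrow> (corner \<Rightarrow> 'v) \<Rightarrow> (corner \<Rightarrow> 'v) \<Rightarrow> 'v set set" where
  "matching_edge \<iota> \<tau> p q =
     ((`) \<iota> ` octahedron - {\<iota> ` tP 1, \<iota> ` tP 3}) \<union>
     generated_cpx (oct_tunnel \<iota> \<tau> 1 p \<union> oct_tunnel \<iota> \<tau> 3 q)"

definition matching_triangle_sides ::
  "(oct \<Rightarrow> 'v) \<Rightarrow> (nat \<Rightarrow> oct \<Rightarrow> corner) \<Rightarrow>
   (corner \<Rightarrow> 'v) \<Rightarrow> (corner \<Rightarrow> 'v) \<Rightarrow> (corner \<Rightarrow> 'v) \<Rightarrow> 'v set set" where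
  "matching_triangle_sides \<iota> \<tau> p q r =
     oct_tunnel \<iota> \<tau> 1 p \<union> oct_tunnel \<iota> \<tau> 3 q \<union> oct_tunnel \<iota> \<tau> 5 r"

definition matching_triangle ::
  "(oct \<Rightarrow> 'v) \<Rightarrow> (nat \<Rightarrow> oct \<Rightarrow> corner) \<Rightarrow>
   (corner \<Rightarrow> 'v) \<Rightarrow> (corner \<Rightarrow> 'v) \<Rightarrow> (corner \<Rightarrow> 'v) \<Rightarrow> 'v set set" where
  "matching_triangle \<iota> \<tau> p q r =
     ((`) \<iota> ` octahedron - {\<iota> ` tP 1, \<iota> ` tP 3, \<iota> ` tP 5}) \<union>
     generated_cpx (matching_triangle_sides \<iota> \<tau> p q r)"

definition matching_triangle_M1 ::
  "(oct \<Rightarrow> 'v) \<Rightarrow> (nat \<Rightarrow> oct \<Rightarrow> corner) \<Rightarrow>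
   (corner \<Rightarrow> 'v) \<Rightarrow> (corner \<Rightarrow> 'v) \<Rightarrow> (corner \<Rightarrow> 'v) \<Rightarrow> 'v set set" where
  "matching_triangle_M1 \<iota> \<tau> p q r =
     {\<iota> ` tP 2, \<iota> ` tP 4, \<iota> ` tP 6, \<iota> ` tP 8} \<union>
     {s \<in> matching_triangle_sides \<iota> \<tau> p q r.
        share_edge s (range p) \<or> share_edge s (range q) \<or> share_edge s (range r)}"

definition matching_triangle_M0 ::
  "(oct \<Rightarrow> 'v) \<Rightarrow> (nat \<Rightarrow> oct \<Rightarrow> corner) \<Rightarrow>
   (corner \<Rightarrow> 'v) \<Rightarrow> (corner \<Rightarrow> 'v) \<Rightarrow> (corner \<Rightarrow> 'v) \<Rightarrow> 'v set set" where
  "matching_triangle_M0 \<iota> \<tau> p q r =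
     {\<iota> ` tP 7} \<union>
     {s \<in> matching_triangle_sides \<iota> \<tau> p q r.
        share_edge s (\<iota> ` tP 1) \<or> share_edge s (\<iota> ` tP 3) \<or> share_edge s (\<iota> ` tP 5)}"

text \<open>
  Names for the matching edges of the configuration \<open>C\<^bsub>t\<^sub>1\<dots>t\<^sub>n\<^esub>\<close>:
  \<open>Rung i\<close> joins \<open>t i\<close> to \<open>t' i\<close>, \<open>Diag i\<close> joins \<open>t i\<close> to \<open>t' (i - 1)\<close>, and
  \<open>Rail i\<close> joins \<open>t' i\<close> to \<open>t' (i + 1)\<close>.
\<close>

datatype link = Rung nat | Diag nat | Rail nat

definition parity_configuration ::
  "(link \<Rightarrow> oct \<Rightarrow> 'v) \<Rightarrow> (link \<Rightarrow> nat \<Rightarrow> oct \<Rightarrow> corner) \<Rightarrow> nat \<Rightarrow>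
   (nat \<Rightarrow> corner \<Rightarrow> 'v) \<Rightarrow> (nat \<Rightarrow> corner \<Rightarrow> 'v) \<Rightarrow> 'v set set" where
  "parity_configuration \<iota> \<tau> n t t' =
     (\<Union>i\<in>{1..n}. matching_edge (\<iota> (Rung i)) (\<tau> (Rung i)) (t i) (t' i)) \<union>
     (\<Union>i\<in>{2..n}. matching_edge (\<iota> (Diag i)) (\<tau> (Diag i)) (t i) (t' (i - 1))) \<union>
     (\<Union>i\<in>{1..n - 1}. matching_edge (\<iota> (Rail i)) (\<tau> (Rail i)) (t' i) (t' (i + 1)))"


section \<open>The matching reduction\<close>

text \<open>
  \<open>TriCopy t\<close> names the copy of the octahedron in the matching triangle of \<open>t\<close>, and
  \<open>EdgeCopy e l\<close> the one in the matching edge \<open>l\<close> of the configuration \<open>C\<close> added for the edge \<open>e\<close>.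
  \<open>Outer t e\<close> is the empty triangle \<open>t\<^sub>e\<close>, and \<open>Inner t e\<close> the corresponding new empty triangle
  \<open>t\<^sub>e'\<close> of the configuration \<open>C\<close> added for \<open>e\<close>.
\<close>

datatype 'a octcopy = TriCopy "'a set" | EdgeCopy "'a set" link

datatype 'a redvertex =
    Outer "'a set" "'a set" corner
  | Inner "'a set" "'a set" corner
  | Octa "'a octcopy" oct

text \<open>
  The construction depends on an order \<open>eds t\<close> of the edges of each triangle \<open>t\<close>, an order
  \<open>inc e\<close> of the triangles incident with each edge \<open>e\<close>, and the choice \<open>tw\<close> of the tunnels.
\<close>

definition reduction_choices ::
  "'a set set \<Rightarrow> ('a set \<Rightarrow> 'a set list) \<Rightarrow> ('a set \<Rightarrow> 'a set list) \<Rightarrow>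
   ('a octcopy \<Rightarrow> nat \<Rightarrow> oct \<Rightarrow> corner) \<Rightarrow> bool" where
  "reduction_choices \<Delta> eds inc tw \<longleftrightarrow>
     (\<forall>t\<in>triangles \<Delta>. distinct (eds t) \<and> set (eds t) = edges_of t) \<and>
     (\<forall>e\<in>edges \<Delta>. distinct (inc e) \<and> set (inc e) = {t \<in> triangles \<Delta>. e \<subseteq> t}) \<and>
     (\<forall>g. \<forall>k\<in>{1, 3, 5}. bij_betw (tw g k) (tP k) UNIV)"

definition red_triangle ::
  "('a set \<Rightarrow> 'a set list) \<Rightarrow> ('a octcopy \<Rightarrow> nat \<Rightarrow> oct \<Rightarrow> corner) \<Rightarrow>
   'a set \<Rightarrow> 'a redvertex set set" where
  "red_triangle eds tw t =
     matching_triangle (Octa (TriCopy t)) (tw (TriCopy t))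
       (Outer t (eds t ! 0)) (Outer t (eds t ! 1)) (Outer t (eds t ! 2))"

definition red_M1 ::
  "('a set \<Rightarrow> 'a set list) \<Rightarrow> ('a octcopy \<Rightarrow> nat \<Rightarrow> oct \<Rightarrow> corner) \<Rightarrow>
   'a set \<Rightarrow> 'a redvertex set set" where
  "red_M1 eds tw t =
     matching_triangle_M1 (Octa (TriCopy t)) (tw (TriCopy t))
       (Outer t (eds t ! 0)) (Outer t (eds t ! 1)) (Outer t (eds t ! 2))"

definition red_M0 ::
  "('a set \<Rightarrow> 'a set list) \<Rightarrow> ('a octcopy \<Rightarrow> nat \<Rightarrow> oct \<Rightarrow> corner) \<Rightarrow>
   'a set \<Rightarrow> 'a redvertex set set" where
  "red_M0 eds tw t =
     matching_triangle_M0 (Octa (TriCopy t)) (tw (TriCopy t))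
       (Outer t (eds t ! 0)) (Outer t (eds t ! 1)) (Outer t (eds t ! 2))"

definition red_parity ::
  "('a set \<Rightarrow> 'a set list) \<Rightarrow> ('a octcopy \<Rightarrow> nat \<Rightarrow> oct \<Rightarrow> corner) \<Rightarrow>
   'a set \<Rightarrow> 'a redvertex set set" where
  "red_parity inc tw e =
     parity_configuration (\<lambda>l. Octa (EdgeCopy e l)) (\<lambda>l. tw (EdgeCopy e l)) (length (inc e))
       (\<lambda>i. Outer (inc e ! (i - 1)) e) (\<lambda>i. Inner (inc e ! (i - 1)) e)"

definition matching_reduction ::
  "'a set set \<Rightarrow> ('a set \<Rightarrow> 'a set list) \<Rightarrow> ('a set \<Rightarrow> 'a set list) \<Rightarrow>
   ('a octcopy \<Rightarrow> nat \<Rightarrow> oct \<Rightarrow> corner) \<Rightarrow> 'a redvertex set set" where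
  "matching_reduction \<Delta> eds inc tw =
     (\<Union>t\<in>triangles \<Delta>. red_triangle eds tw t) \<union> (\<Union>e\<in>edges \<Delta>. red_parity inc tw e)"

definition corresponding_matching ::
  "'a set set \<Rightarrow> ('a set \<Rightarrow> 'a set list) \<Rightarrow> ('a set \<Rightarrow> 'a set list) \<Rightarrow>
   ('a octcopy \<Rightarrow> nat \<Rightarrow> oct \<Rightarrow> corner) \<Rightarrow> 'a set set \<Rightarrow> 'a redvertex set set \<Rightarrow> bool" where
  "corresponding_matching \<Delta> eds inc tw C M \<longleftrightarrow>
     perfect_matching (matching_reduction \<Delta> eds inc tw) M \<and>
     (\<forall>t\<in>triangles \<Delta>. M \<inter> triangles (red_triangle eds tw t) =
        (if t \<in> C then red_M1 eds tw t else red_M0 eds tw t))"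


section \<open>Consistency of the conventions\<close>

lemma tP_simps:
  "tP 1 = {Xp, Yp, Zp}" "tP 2 = {Xm, Ym, Zm}" "tP 3 = {Xp, Ym, Zm}" "tP 4 = {Xm, Yp, Zp}"
  "tP 5 = {Xm, Yp, Zm}" "tP 6 = {Xp, Ym, Zp}" "tP 7 = {Xm, Ym, Zp}" "tP 8 = {Xp, Yp, Zm}"
  by (simp_all add: tP_def numeral_eq_Suc)

lemma labels_eq: "{1..8} = {1, 2, 3, 4, 5, 6, 7, 8::nat}"
  by auto

lemma card_tP: "i \<in> {1..8} \<Longrightarrow> finite (tP i) \<and> card (tP i) = 3"
  unfolding labels_eq by (elim insertE emptyE) (simp_all only: tP_simps, simp_all)

lemma octahedron_eq: "octahedron = generated_cpx (tP ` {1..8})"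
proof -
  have "{{x, y, z} |x y z. x \<in> {Xp, Xm} \<and> y \<in> {Yp, Ym} \<and> z \<in> {Zp, Zm}} = tP ` {1..8}"
    (is "?L = _")
  proof
    have "{x, y, z} \<in> tP ` {1..8}"
      if "x \<in> {Xp, Xm}" "y \<in> {Yp, Ym}" "z \<in> {Zp, Zm}" for x y z
      using that unfolding labels_eq image_insert image_empty tP_simps
      by (elim insertE emptyE) simp_all
    then show "?L \<subseteq> tP ` {1..8}" by blast
    show "tP ` {1..8} \<subseteq> ?L"
      unfolding labels_eq image_insert image_empty tP_simps by blast
  qed
  then show ?thesis unfolding octahedron_def by simp
qed

lemma inj_on_tP: "inj_on tP {1..8}"
proof (rule inj_on_inverseI)
  define label where "label S =
    (if Xm \<in> S then (if Ym \<in> S then (if Zm \<in> S then 2 else 7) else (if Zm \<in> S then 5 else 4))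
     else (if Ym \<in> S then (if Zm \<in> S then 3 else 6) else (if Zm \<in> S then 8 else 1 :: nat)))" for S
  show "label (tP i) = i" if "i \<in> {1..8}" for i
    using that unfolding labels_eq
    by (elim insertE emptyE) (simp_all only: tP_simps label_def, simp_all)
qed

lemma bij_betw_tP: "bij_betw tP {1..8} (triangles octahedron)"
proof -
  have "t \<in> tP ` {1..8}" if "t \<in> triangles octahedron" for t
  proof -
    from that obtain i where "i \<in> {1..8}" "t \<subseteq> tP i" "card t = 3"
      unfolding triangles_def octahedron_eq generated_cpx_def by blast
    then show ?thesis using card_tP[of i] by (metis card_subset_eq imageI)
  qed
  moreover have "tP i \<in> triangles octahedron" if "i \<in> {1..8}" for i
    using that card_tP[OF that] unfolding triangles_def octahedron_eq generated_cpx_def by auto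
  ultimately have "tP ` {1..8} = triangles octahedron" by blast
  with inj_on_tP show ?thesis by (simp add: bij_betw_def)
qed

lemma same_parity_not_share_edge:
  assumes "i \<in> {1..8}" "j \<in> {1..8}" "i \<noteq> j" "even i \<longleftrightarrow> even j"
  shows "\<not> share_edge (tP i) (tP j)"
proof -
  have "\<exists>v. tP i \<inter> tP j \<subseteq> {v}"
    using assms unfolding labels_eq
    by (elim insertE emptyE) (simp_all only: tP_simps, auto)
  then obtain v where v: "tP i \<inter> tP j \<subseteq> {v}" ..
  have "card e \<noteq> 2" if "e \<subseteq> tP i" "e \<subseteq> tP j" for e
  proof -
    have "card e \<le> card {v}" using v that by (intro card_mono) auto
    then show ?thesis by simp
  qed
  then show ?thesis unfolding share_edge_def edges_of_def by auto
qed

lemma reduction_choices_exist: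
  assumes "triangular_configuration \<Delta>"
  shows "\<exists>eds inc tw. reduction_choices \<Delta> eds inc tw"
proof -
  have "finite (triangles \<Delta>)" "\<forall>t\<in>triangles \<Delta>. finite t"
    using assms unfolding triangular_configuration_def simplicial_cpx_def triangles_def by auto
  then have "\<forall>t\<in>triangles \<Delta>. finite (edges_of t)"
      and "\<forall>e. finite {t \<in> triangles \<Delta>. e \<subseteq> t}"
    by (auto simp: edges_of_def)
  then have "\<forall>t\<in>triangles \<Delta>. \<exists>xs. set xs = edges_of t \<and> distinct xs"
      and "\<forall>e. \<exists>xs. set xs = {t \<in> triangles \<Delta>. e \<subseteq> t} \<and> distinct xs"
    by (blast intro: finite_distinct_list)+
  then obtain eds inc
    where eds: "\<forall>t\<in>triangles \<Delta>. set (eds t) = edges_of t \<and> distinct (eds t)"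
      and inc: "\<forall>e. set (inc e) = {t \<in> triangles \<Delta>. e \<subseteq> t} \<and> distinct (inc e)"
    using bchoice[of "triangles \<Delta>" "\<lambda>t xs. set xs = edges_of t \<and> distinct xs"]
      choice[of "\<lambda>e xs. set xs = {t \<in> triangles \<Delta>. e \<subseteq> t} \<and> distinct xs"] by blast
  have "\<forall>k\<in>{1, 3, 5}. \<exists>h. bij_betw h (tP k) (UNIV :: corner set)"
  proof (intro ballI finite_same_card_bij)
    fix k :: nat assume k: "k \<in> {1, 3, 5}"
    have U: "(UNIV :: corner set) = {C1, C2, C3}" using corner.exhaust by auto
    show "finite (tP k)" "finite (UNIV :: corner set)" "card (tP k) = card (UNIV :: corner set)"
      using card_tP[of k] k unfolding U by auto
  qed
  then obtain h where "\<forall>k\<in>{1, 3, 5}. bij_betw (h k) (tP k) (UNIV :: corner set)"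
    by (rule bchoice[THEN exE])
  with eds inc have "reduction_choices \<Delta> eds inc (\<lambda>g. h)"
    unfolding reduction_choices_def by simp
  then show ?thesis by blast
qed

end

theory Submission
  imports Defs
begin

text \<open>
  Consider a copy of the octahedron in which some odd-labelled triangles have been replaced by
  tunnels. The edges joining the two ends of a tunnel lie in two side triangles each, and they
  arrange the six sides in a cycle of alternately \<open>near\<close> and \<open>far\<close> ones, according to the end with
  which a side shares an edge. A perfect matching therefore contains all near sides or all far sides.
  The near sides cover the same octahedron edges as the removed triangle, so they can be regarded as
  selecting it. Of two adjacent octahedron triangles exactly one is selected; as the adjacency graph
  is a cube, either all even-labelled or all odd-labelled triangles are selected. Thus the copy has
  just two states: in state \<open>on\<close> it covers the edges of the empty triangles (hubs) at which its tunnels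
  end, in state \<open>off\<close> it covers none of them. For matching triangles these are \<open>M\<^sup>1\<close> and \<open>M\<^sup>0\<close>.
  Consequently (\<open>perfect_matching_iff_select\<close>) perfect matchings correspond to sets of copies, those
  in state \<open>on\<close>, such that every hub belongs to exactly one of them.

  It remains to solve these conditions around an edge \<open>e\<close> with incident triangles \<open>t\<^sub>1, \<dots>, t\<^sub>n\<close>. There
  the links \<open>Rung\<close>, \<open>Diag\<close> and \<open>Rail\<close> form a ladder in which the links \<open>Diag (i + 1)\<close> and \<open>Rail i\<close> lead
  from position \<open>i\<close> to position \<open>i + 1\<close>. By induction on \<open>i\<close>, the number of these two links in state
  \<open>on\<close> is the parity of the number of matching triangles among \<open>t\<^sub>1, \<dots>, t\<^sub>i\<close> in state \<open>on\<close>
  (\<open>parity_chain_iff\<close>). As nothing leads beyond position \<open>n\<close>, the states of the matching triangles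
  extend to the links if and only if an even number of them is \<open>on\<close>, and the extension is unique.
  So perfect matchings correspond to sets of triangles that meet every edge evenly, and these sets
  are exactly the sets of triangles of even subconfigurations.
\<close>

section \<open>Exact covers of edges\<close>

lemma triangles_generated_cpx:
  assumes "\<forall>t\<in>S. card t = 3"
  shows "triangles (generated_cpx S) = S"
proof (intro equalityI subsetI)
  have fin: "finite t" if "t \<in> S" for t
    using assms that by (metis card.infinite zero_neq_numeral)
  fix s assume "s \<in> triangles (generated_cpx S)"
  then obtain t where t: "t \<in> S" "s \<subseteq> t" "card s = 3"
    unfolding triangles_def generated_cpx_def by blast
  then have "s = t" using fin assms by (metis card_subset_eq)
  with t show "s \<in> S" by simp
next
  fix s assume "s \<in> S"
  moreover from this have "card s = 3" using assms by blast
  moreover from this have "s \<noteq> {}" by auto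
  ultimately show "s \<in> triangles (generated_cpx S)"
    unfolding triangles_def generated_cpx_def by blast
qed

lemma edges_generated_cpx: "edges (generated_cpx S) = (\<Union>t\<in>S. edges_of t)"
  unfolding edges_def generated_cpx_def edges_of_def by (auto dest: card_2_iff[THEN iffD1])

text \<open>
  An edge shared by two triangles of \<open>M\<close> belongs to the complex, so covering every edge exactly once
  already rules out that triangles of \<open>M\<close> share an edge.
\<close>

lemma perfect_matching_generated_cpx:
  assumes "\<forall>t\<in>S. card t = 3"
  shows "perfect_matching (generated_cpx S) M \<longleftrightarrow>
    M \<subseteq> S \<and> (\<forall>t\<in>S. \<forall>e\<in>edges_of t. \<exists>!u. u \<in> M \<and> e \<subseteq> u)"
    (is "_ \<longleftrightarrow> M \<subseteq> S \<and> ?cover")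
proof -
  have "\<not> share_edge s t" if "M \<subseteq> S" ?cover "s \<in> M" "t \<in> M" "s \<noteq> t" for s t
  proof
    assume "share_edge s t"
    then obtain e where "e \<in> edges_of s" "e \<in> edges_of t" unfolding share_edge_def by blast
    moreover from this that have "\<exists>!u. u \<in> M \<and> e \<subseteq> u" by blast
    ultimately show False using that unfolding edges_of_def by blast
  qed
  then have "M \<subseteq> S \<and> ?cover \<longrightarrow> (\<forall>s\<in>M. \<forall>t\<in>M. s \<noteq> t \<longrightarrow> \<not> share_edge s t)"
    by (intro impI ballI) simp
  moreover have "perfect_matching (generated_cpx S) M \<longleftrightarrow>
    (M \<subseteq> S \<and> (\<forall>s\<in>M. \<forall>t\<in>M. s \<noteq> t \<longrightarrow> \<not> share_edge s t)) \<and> ?cover"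
    unfolding perfect_matching_def matching_def triangles_generated_cpx[OF assms]
      edges_generated_cpx
    by (simp only: ball_UN)
  ultimately show ?thesis by argo
qed

text \<open>
  All edges of the reduction outside the empty triangles lie in exactly two triangles. For such an
  edge, being covered exactly once is an exclusive or.
\<close>

lemma ex1_iff_xor:
  assumes "M \<subseteq> S" "a \<noteq> b" "a \<in> S" "b \<in> S" "\<And>t. t \<in> S \<Longrightarrow> e \<subseteq> t \<longleftrightarrow> t = a \<or> t = b"
  shows "(\<exists>!t. t \<in> M \<and> e \<subseteq> t) \<longleftrightarrow> (a \<in> M \<longleftrightarrow> b \<notin> M)"
proof -
  have "t \<in> M \<and> e \<subseteq> t \<longleftrightarrow> t \<in> M \<and> (t = a \<or> t = b)" for t
    using assms(1,5) by blast
  then have "(\<exists>!t. t \<in> M \<and> e \<subseteq> t) \<longleftrightarrow> (\<exists>!t. t \<in> M \<and> (t = a \<or> t = b))" by simp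
  also have "\<dots> \<longleftrightarrow> (a \<in> M \<longleftrightarrow> b \<notin> M)" using assms(2) by blast
  finally show ?thesis .
qed

section \<open>Adjacency of octahedron triangles\<close>

fun antipode :: "oct \<Rightarrow> oct" where
  "antipode Xp = Xm" | "antipode Xm = Xp"
| "antipode Yp = Ym" | "antipode Ym = Yp"
| "antipode Zp = Zm" | "antipode Zm = Zp"

text \<open>
  The label of the triangle that shares with \<open>tP i\<close> the edge opposite to its vertex \<open>x\<close>. The given
  labelling makes the labels of two triangles that differ in a vertex \<open>Xp\<close> or \<open>Xm\<close> add up to 5 or 13;
  the sums are 7 and 11 for \<open>Yp\<close> and \<open>Ym\<close>, and always 9 for \<open>Zp\<close> and \<open>Zm\<close>. All sums are odd, so
  adjacent triangles have labels of different parity.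
\<close>

definition neighbour_label :: "oct \<Rightarrow> nat \<Rightarrow> nat" where
  "neighbour_label x i =
    (if x \<in> {Xp, Xm} then if i \<le> 4 then 5 - i else 13 - i
     else if x \<in> {Yp, Ym} then if i \<in> {1, 2, 5, 6} then 7 - i else 11 - i
     else 9 - i)"

lemma neighbour_label:
  assumes "i \<in> {1..8}"
  shows "neighbour_label x i \<in> {1..8}" "even (neighbour_label x i) \<longleftrightarrow> odd i"
  using assms unfolding labels_eq by (elim insertE emptyE; simp add: neighbour_label_def)+

lemma tP_neighbour_label:
  assumes "i \<in> {1..8}" "x \<in> tP i"
  shows "tP (neighbour_label x i) = insert (antipode x) (tP i - {x})"
proof -
  have "\<forall>x\<in>tP i. tP (neighbour_label x i) = insert (antipode x) (tP i - {x})"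
    using assms(1) unfolding labels_eq
    by (elim insertE emptyE; hypsubst; simp only: tP_simps ball_simps neighbour_label_def; simp add: tP_def insert_Diff_if; auto)
  then show ?thesis using assms(2) by blast
qed

lemma antipode_in_tP: "i \<in> {1..8} \<Longrightarrow> antipode x \<in> tP i \<longleftrightarrow> x \<notin> tP i"
  unfolding labels_eq by (elim insertE emptyE; hypsubst; cases x; simp add: tP_def)

text \<open>
  A triangle of the octahedron has one vertex out of each antipodal pair. A triangle containing the
  edge opposite to \<open>x\<close> in \<open>tP i\<close> is therefore completed by \<open>x\<close> or by its antipode.
\<close>

lemma octahedron_edge:
  assumes "i \<in> {1..8}" "x \<in> tP i"
  shows "antipode x \<in> tP (neighbour_label x i)"
    and "tP (neighbour_label x i) - {antipode x} = tP i - {x}"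
    and "k \<in> {1..8} \<Longrightarrow> tP i - {x} \<subseteq> tP k \<longleftrightarrow> k = i \<or> k = neighbour_label x i"
proof -
  let ?j = "neighbour_label x i"
  have tPj: "tP ?j = insert (antipode x) (tP i - {x})" using tP_neighbour_label assms by blast
  have notin: "antipode x \<notin> tP i" using antipode_in_tP assms by blast
  have j: "?j \<in> {1..8}" using neighbour_label[OF assms(1)] by auto
  show "antipode x \<in> tP ?j" "tP ?j - {antipode x} = tP i - {x}"
    using notin unfolding tPj by auto
  show "tP i - {x} \<subseteq> tP k \<longleftrightarrow> k = i \<or> k = ?j" if k: "k \<in> {1..8}"
  proof
    assume sub: "tP i - {x} \<subseteq> tP k"
    have "l = k" if l: "l \<in> {1..8}" "tP l \<subseteq> tP k" for l
    proof -
      have "tP l = tP k" using card_tP[OF l(1)] card_tP[OF k] l(2) card_subset_eq by metis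
      then show ?thesis using inj_on_tP l(1) k by (meson inj_onD)
    qed
    moreover have "tP i \<subseteq> tP k \<or> tP ?j \<subseteq> tP k"
      using sub antipode_in_tP[OF k, of x] unfolding tPj by blast
    ultimately show "k = i \<or> k = ?j" using assms(1) j by blast
  next
    show "k = i \<or> k = ?j \<Longrightarrow> tP i - {x} \<subseteq> tP k" using tPj by blast
  qed
qed

lemma edges_of_triangle:
  assumes "card t = 3"
  shows "edges_of t = (\<lambda>x. t - {x}) ` t"
proof (intro equalityI subsetI)
  have fin: "finite t" using assms by (metis card.infinite zero_neq_numeral)
  fix e assume "e \<in> edges_of t"
  then have e: "e \<subseteq> t" "card e = 2" unfolding edges_of_def by auto
  then have "card (t - e) = 1" using assms fin by (simp add: card_Diff_subset finite_subset)
  then obtain x where "t - e = {x}" by (auto simp: card_1_singleton_iff)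
  with e have "x \<in> t" "e = t - {x}" by blast+
  then show "e \<in> (\<lambda>x. t - {x}) ` t" by blast
next
  fix e assume "e \<in> (\<lambda>x. t - {x}) ` t"
  then show "e \<in> edges_of t" using assms unfolding edges_of_def by (auto simp: card_Diff_singleton)
qed

lemma share_edgeI: "e \<subseteq> s \<inter> t \<Longrightarrow> card e = 2 \<Longrightarrow> share_edge s t"
  unfolding share_edge_def edges_of_def by auto

lemma inter_not_share_edge: "s \<inter> t \<subseteq> {v} \<Longrightarrow> \<not> share_edge s t"
proof
  assume "s \<inter> t \<subseteq> {v}" "share_edge s t"
  then obtain e where "e \<subseteq> {v}" "card e = 2" unfolding share_edge_def edges_of_def by blast
  then show False using card_mono[of "{v}" e] by simp
qed

lemma tP_third_vertex:
  assumes "i \<in> {1..8}" "x \<in> tP i" "y \<in> tP i" "x \<noteq> y"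
  obtains z where "tP i = {x, y, z}" "x \<noteq> z" "y \<noteq> z"
proof -
  have "card (tP i - {x, y}) = 1"
    using card_tP[OF assms(1)] assms(2-) by (simp add: card_Diff_subset)
  then obtain z where "tP i - {x, y} = {z}" by (rule card_1_singletonE)
  then have "tP i = {x, y, z}" "x \<noteq> z" "y \<noteq> z" using assms(2,3) by blast+
  then show thesis by (rule that)
qed

lemma tP_other_vertex:
  assumes "i \<in> {1..8}"
  obtains y where "y \<in> tP i" "y \<noteq> x"
proof -
  have "\<not> tP i \<subseteq> {x}"
  proof
    assume "tP i \<subseteq> {x}"
    then have "card (tP i) \<le> card {x}" by (intro card_mono) auto
    then show False using card_tP[OF assms] by simp
  qed
  then show thesis using that by blast
qed

section \<open>Complexes of octahedron copies joined by tunnels\<close>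

text \<open>
  Matching edges and matching triangles are the cases \<open>E = {1, 3}\<close> and \<open>E = {1, 3, 5}\<close>.
\<close>

definition gadget ::
  "(oct \<Rightarrow> 'v) \<Rightarrow> (nat \<Rightarrow> oct \<Rightarrow> corner) \<Rightarrow> nat set \<Rightarrow> (nat \<Rightarrow> corner \<Rightarrow> 'v) \<Rightarrow> 'v set set" where
  "gadget \<iota> \<tau> E p =
     ((`) \<iota> ` octahedron - (\<lambda>k. \<iota> ` tP k) ` E) \<union> generated_cpx (\<Union>k\<in>E. oct_tunnel \<iota> \<tau> k (p k))"

text \<open>
  Copies \<open>g\<close> of the octahedron, each with the triangles labelled by \<open>E g\<close> removed and replaced by
  tunnels; the tunnel at label \<open>k\<close> leads to the empty triangle \<open>p g k\<close>, called a hub. Several copies may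
  have the same hub, but otherwise vertices are not identified. Which copies meet at which hub is left
  open, so that the matching edges and matching triangles of the reduction are treated at once.
\<close>

locale gadget_complex =
  fixes G :: "'g set"
    and \<iota> :: "'g \<Rightarrow> oct \<Rightarrow> 'v"
    and \<tau> :: "'g \<Rightarrow> nat \<Rightarrow> oct \<Rightarrow> corner"
    and E :: "'g \<Rightarrow> nat set"
    and p :: "'g \<Rightarrow> nat \<Rightarrow> corner \<Rightarrow> 'v"
  assumes oct_eq [simp]: "\<iota> g x = \<iota> h y \<longleftrightarrow> g = h \<and> x = y"
    and hub_eq [simp]: "p g k c = p h l d \<longleftrightarrow> p g k = p h l \<and> c = d"
    and oct_neq_hub [simp]: "\<iota> g x \<noteq> p h k c"
    and ends: "g \<in> G \<Longrightarrow> E g \<subseteq> {1, 3, 5}"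
    and inj_hub: "g \<in> G \<Longrightarrow> inj_on (p g) (E g)"
    and twist: "g \<in> G \<Longrightarrow> k \<in> E g \<Longrightarrow> bij_betw (\<tau> g k) (tP k) UNIV"
begin

lemma hub_neq_oct [simp]: "p h k c \<noteq> \<iota> g x"
  using oct_neq_hub by metis

definition face :: "'g \<Rightarrow> nat \<Rightarrow> 'v set" where
  "face g i = \<iota> g ` tP i"

text \<open>
  The two kinds of side triangles of a tunnel: \<open>near\<close> sides contain an edge of the removed octahedron
  triangle, \<open>far\<close> sides contain an edge of the hub.
\<close>

definition near :: "'g \<Rightarrow> nat \<Rightarrow> oct \<Rightarrow> 'v set" where
  "near g k x = insert (p g k (\<tau> g k x)) (\<iota> g ` (tP k - {x}))"

definition far :: "'g \<Rightarrow> nat \<Rightarrow> oct \<Rightarrow> 'v set" where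
  "far g k x = insert (\<iota> g x) (p g k ` \<tau> g k ` (tP k - {x}))"

text \<open>
  The triangle that covers the octahedron edge opposite to \<open>x\<close> on the side of \<open>tP i\<close>: if \<open>tP i\<close> is
  removed, a near side of its tunnel takes over this role.
\<close>

definition piece :: "'g \<Rightarrow> nat \<Rightarrow> oct \<Rightarrow> 'v set" where
  "piece g i x = (if i \<in> E g then near g i x else face g i)"

lemma piece_contains: "x \<in> tP i \<Longrightarrow> \<iota> g ` (tP i - {x}) \<subseteq> piece g i x"
  unfolding piece_def near_def face_def by auto

text \<open>
  The two possible states of a copy. In both of them all edges that belong to the copy alone are
  covered once; the hubs are covered by \<open>on\<close> and left uncovered by \<open>off\<close>.
\<close>

definition on :: "'g \<Rightarrow> 'v set set" where
  "on g = face g ` {2, 4, 6, 8} \<union> (\<Union>k\<in>E g. far g k ` tP k)"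

definition off :: "'g \<Rightarrow> 'v set set" where
  "off g = face g ` ({1, 3, 5, 7} - E g) \<union> (\<Union>k\<in>E g. near g k ` tP k)"

definition tris :: "'v set set" where
  "tris = (\<Union>g\<in>G. on g \<union> off g)"

lemma mem_triangles [simp]:
  "\<iota> g y \<in> face h i \<longleftrightarrow> g = h \<and> y \<in> tP i"
  "\<iota> g y \<in> near h k x \<longleftrightarrow> g = h \<and> y \<in> tP k \<and> y \<noteq> x"
  "\<iota> g y \<in> far h k x \<longleftrightarrow> g = h \<and> y = x"
  "p g l c \<notin> face h i"
  "p g l c \<in> near h k x \<longleftrightarrow> p g l = p h k \<and> c = \<tau> h k x"
  "p g l c \<in> far h k x \<longleftrightarrow> p g l = p h k \<and> c \<in> \<tau> h k ` (tP k - {x})"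
  unfolding face_def near_def far_def by auto

lemma card_octa_edge:
  assumes "i \<in> {1..8}" "x \<in> tP i"
  shows "card (\<iota> g ` (tP i - {x})) = 2"
proof -
  have "inj_on (\<iota> g) (tP i - {x})" by (rule inj_onI) simp
  then show ?thesis using card_tP[OF assms(1)] assms(2) by (simp add: card_image)
qed

lemma card_hub_edge: "card (p g k ` (- {c})) = 2"
proof -
  have "inj_on (p g k) (- {c})" by (rule inj_onI) simp
  moreover have "- {C1} = {C2, C3}" "- {C2} = {C1, C3}" "- {C3} = {C1, C2}"
    using corner.exhaust by auto
  then have "card (- {c}) = 2" by (cases c) simp_all
  ultimately show ?thesis by (simp add: card_image)
qed

lemma end_label:
  assumes "g \<in> G" "k \<in> E g"
  shows "k \<in> {1..8}" "odd k"
  using ends[OF assms(1)] assms(2) by auto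

lemma twist_remove:
  assumes "g \<in> G" "k \<in> E g" "x \<in> tP k"
  shows "\<tau> g k ` (tP k - {x}) = - {\<tau> g k x}"
proof -
  have inj: "inj_on (\<tau> g k) (tP k)" and im: "\<tau> g k ` tP k = UNIV"
    using twist[OF assms(1,2)] unfolding bij_betw_def by auto
  have "\<tau> g k ` (tP k - {x}) = \<tau> g k ` tP k - \<tau> g k ` {x}"
    using inj_on_image_set_diff[OF inj, of "tP k" "{x}"] assms(3) by simp
  then show ?thesis unfolding im by auto
qed

lemma on_Un_off:
  assumes "g \<in> G"
  shows "on g \<union> off g =
    face g ` ({1..8} - E g) \<union> (\<Union>k\<in>E g. near g k ` tP k \<union> far g k ` tP k)"
proof -
  have labels: "{1..8} - E g = {2, 4, 6, 8} \<union> ({1, 3, 5, 7} - E g)"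
    using ends[OF assms] unfolding labels_eq by auto
  show ?thesis unfolding labels on_def off_def by blast
qed

lemma tris_cases:
  assumes "t \<in> tris"
  obtains (face) g i where "g \<in> G" "i \<in> {1..8}" "i \<notin> E g" "t = face g i"
    | (near) g k x where "g \<in> G" "k \<in> E g" "x \<in> tP k" "t = near g k x"
    | (far) g k x where "g \<in> G" "k \<in> E g" "x \<in> tP k" "t = far g k x"
proof -
  obtain g where g: "g \<in> G" "t \<in> on g \<union> off g" using assms unfolding tris_def by blast
  then have "t \<in> face g ` ({1..8} - E g) \<or> (\<exists>k\<in>E g. t \<in> near g k ` tP k \<or> t \<in> far g k ` tP k)"
    using on_Un_off[OF g(1)] by simp
  then show thesis
  proof (elim disjE bexE)
    show thesis if "t \<in> face g ` ({1..8} - E g)"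
      using that face[OF g(1)] by (elim imageE DiffE)
    show thesis if "k \<in> E g" "t \<in> near g k ` tP k" for k
      using that near[OF g(1)] by (elim imageE)
    show thesis if "k \<in> E g" "t \<in> far g k ` tP k" for k
      using that far[OF g(1)] by (elim imageE)
  qed
qed

lemma tris_intros:
  assumes "g \<in> G"
  shows "i \<in> {1..8} \<Longrightarrow> i \<notin> E g \<Longrightarrow> face g i \<in> tris"
    and "k \<in> E g \<Longrightarrow> x \<in> tP k \<Longrightarrow> near g k x \<in> tris"
    and "k \<in> E g \<Longrightarrow> x \<in> tP k \<Longrightarrow> far g k x \<in> tris"
proof -
  have sub: "on g \<union> off g \<subseteq> tris" unfolding tris_def using assms by (rule UN_upper)
  show "i \<in> {1..8} \<Longrightarrow> i \<notin> E g \<Longrightarrow> face g i \<in> tris"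
    by (rule subsetD[OF sub]) (simp add: on_Un_off[OF assms])
  show "k \<in> E g \<Longrightarrow> x \<in> tP k \<Longrightarrow> near g k x \<in> tris"
    by (rule subsetD[OF sub]) (auto simp add: on_Un_off[OF assms])
  show "k \<in> E g \<Longrightarrow> x \<in> tP k \<Longrightarrow> far g k x \<in> tris"
    by (rule subsetD[OF sub]) (auto simp add: on_Un_off[OF assms])
qed

lemma card_tris:
  assumes "t \<in> tris"
  shows "card t = 3"
  using assms
proof (cases rule: tris_cases)
  case (face g i)
  have "inj_on (\<iota> g) (tP i)" by (rule inj_onI) simp
  then show ?thesis using face card_tP unfolding face_def by (simp add: card_image)
next
  case (near g k x)
  have "card (\<iota> g ` (tP k - {x})) = 2" using card_octa_edge end_label near by blast
  moreover have "p g k (\<tau> g k x) \<notin> \<iota> g ` (tP k - {x})" by auto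
  moreover have "finite (tP k)" using card_tP[of k] end_label near by blast
  ultimately show ?thesis using near unfolding near_def by simp
next
  case (far g k x)
  have "inj_on (p g k) X" for X by (rule inj_onI) simp
  moreover have "inj_on (\<tau> g k) (tP k - {x})"
    using twist far unfolding bij_betw_def by (meson inj_on_diff)
  ultimately have "card (p g k ` \<tau> g k ` (tP k - {x})) = 2"
    using card_tP[of k] end_label far by (simp add: card_image)
  moreover have "\<iota> g x \<notin> p g k ` \<tau> g k ` (tP k - {x})" by auto
  moreover have "finite (tP k)" using card_tP[of k] end_label far by blast
  ultimately show ?thesis using far unfolding far_def by simp
qed

lemma oct_tunnel_eq: "oct_tunnel (\<iota> g) (\<tau> g) k (p g k) = near g k ` tP k \<union> far g k ` tP k"
  unfolding tunnel_def near_def far_def by (simp add: image_comp)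

text \<open>
  Removing \<open>tP k\<close> does not remove its edges from the complex, since these are contained in near sides.
  Hence nothing but the triangles is needed to generate the gadget.
\<close>

lemma gadget_eq:
  assumes g: "g \<in> G"
  shows "gadget (\<iota> g) (\<tau> g) (E g) (p g) = generated_cpx (on g \<union> off g)"
proof -
  have gen: "generated_cpx (X \<union> Y) = generated_cpx X \<union> generated_cpx Y" for X Y :: "'v set set"
    unfolding generated_cpx_def by blast
  let ?O = "(`) (\<iota> g) ` octahedron - (\<lambda>k. \<iota> g ` tP k) ` E g"
  let ?F = "generated_cpx (face g ` ({1..8} - E g))"
  let ?T = "generated_cpx (\<Union>k\<in>E g. near g k ` tP k \<union> far g k ` tP k)"
  have "s \<in> ?F \<union> ?T" if s: "s \<in> (`) (\<iota> g) ` octahedron" "s \<notin> (\<lambda>k. \<iota> g ` tP k) ` E g" for s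
  proof -
    obtain u i where u: "u \<noteq> {}" "u \<subseteq> tP i" "i \<in> {1..8}" "s = \<iota> g ` u"
      using s(1) unfolding octahedron_eq generated_cpx_def by blast
    show ?thesis
    proof (cases "i \<in> E g")
      case False
      then have "face g i \<in> face g ` ({1..8} - E g)" using u(3) by simp
      moreover have "s \<noteq> {}" "s \<subseteq> face g i" using u unfolding face_def by auto
      ultimately show ?thesis unfolding generated_cpx_def by blast
    next
      case True
      \<comment> \<open>a proper face of a removed triangle is contained in an edge of it\<close>
      then obtain x where "x \<in> tP i" "u \<subseteq> tP i - {x}" using s(2) u by blast
      then have "s \<subseteq> near g i x" using u(4) unfolding near_def by blast
      moreover have "near g i x \<in> (\<Union>k\<in>E g. near g k ` tP k \<union> far g k ` tP k)"
        using True \<open>x \<in> tP i\<close> by blast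
      moreover have "s \<noteq> {}" using u by simp
      ultimately show ?thesis unfolding generated_cpx_def by blast
    qed
  qed
  moreover have "s \<in> (`) (\<iota> g) ` octahedron - (\<lambda>k. \<iota> g ` tP k) ` E g" if s: "s \<in> ?F" for s
  proof -
    obtain t where t: "s \<noteq> {}" "s \<subseteq> t" "t \<in> face g ` ({1..8} - E g)"
      using s unfolding generated_cpx_def by blast
    from t(3) obtain i where "i \<in> {1..8} - E g" "t = face g i" by (rule imageE)
    with t have i: "s \<noteq> {}" "s \<subseteq> \<iota> g ` tP i" "i \<in> {1..8}" "i \<notin> E g"
      unfolding face_def by simp_all
    then obtain u where u: "u \<subseteq> tP i" "s = \<iota> g ` u" by (meson subset_imageE)
    then have "s \<in> (`) (\<iota> g) ` octahedron"
      using i unfolding octahedron_eq generated_cpx_def by blast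
    moreover have "s \<noteq> \<iota> g ` tP k" if k: "k \<in> E g" for k
    proof
      assume "s = \<iota> g ` tP k"
      moreover have "inj (\<iota> g)" by (rule injI) simp
      ultimately have "tP k \<subseteq> tP i" using u by (simp add: inj_image_eq_iff)
      then have "tP k = tP i" 
        using card_tP[of k] card_tP[OF i(3)] end_label[OF g k] card_subset_eq by metis
      then have "k = i" using inj_on_tP end_label[OF g k] i(3) by (meson inj_onD)
      with k i show False by simp
    qed
    ultimately show ?thesis by blast
  qed
  ultimately have sub: "?O \<subseteq> ?F \<union> ?T" "?F \<subseteq> ?O" by (intro subsetI; simp)+
  have "O' \<union> T = F \<union> T" if "O' \<subseteq> F \<union> T" "F \<subseteq> O'" for O' F T :: "'v set set"
    using that by blast
  from this[OF sub] have "?O \<union> ?T = ?F \<union> ?T" .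
  then show ?thesis unfolding gadget_def on_Un_off[OF g] gen oct_tunnel_eq .
qed

lemma union_gadgets_eq:
  "(\<Union>g\<in>G. gadget (\<iota> g) (\<tau> g) (E g) (p g)) = generated_cpx tris"
proof -
  have "(\<Union>g\<in>G. gadget (\<iota> g) (\<tau> g) (E g) (p g)) = (\<Union>g\<in>G. generated_cpx (on g \<union> off g))"
    using gadget_eq by simp
  also have "\<dots> = generated_cpx tris" unfolding generated_cpx_def tris_def by auto
  finally show ?thesis .
qed

text \<open>
  The two triangles of the octahedron at an edge have labels of different parity, so at most one of
  them is removed; its place is then taken by one near side.
\<close>

lemma cover_octa_edge:
  assumes g: "g \<in> G" and i: "i \<in> {1..8}" "x \<in> tP i" and M: "M \<subseteq> tris"
  shows "(\<exists>!t. t \<in> M \<and> \<iota> g ` (tP i - {x}) \<subseteq> t) \<longleftrightarrow>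
    (piece g i x \<in> M \<longleftrightarrow> piece g (neighbour_label x i) (antipode x) \<notin> M)"
proof (rule ex1_iff_xor[OF M])
  let ?e = "tP i - {x}" and ?j = "neighbour_label x i"
  note j = neighbour_label[OF i(1), of x] and edge = octahedron_edge[OF i]
  have card_e: "card ?e = 2" using card_tP[OF i(1)] i(2) by (simp add: card_Diff_singleton)
  then obtain a b where "?e = {a, b}" "a \<noteq> b" unfolding card_2_iff by blast
  then have ne: "?e \<noteq> {}" and not1: "\<And>y. \<not> ?e \<subseteq> {y}" by auto
  have inj: "face g i \<noteq> face g ?j"
  proof -
    have "inj (\<iota> g)" by (rule injI) simp
    then have "tP i = tP ?j" if "face g i = face g ?j"
      using that unfolding face_def by (simp add: inj_image_eq_iff)
    then show ?thesis using inj_on_tP i(1) j by (metis inj_onD)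
  qed
  have near_neq: "near g k y \<noteq> face g l" for k y l
    using mem_triangles(4)[of g k "\<tau> g k y" g l] mem_triangles(5)[of g k "\<tau> g k y" g k y] by metis
  have "i \<notin> E g \<or> ?j \<notin> E g" using end_label[OF g] j(2) by blast
  then show "piece g i x \<noteq> piece g ?j (antipode x)"
    using inj near_neq unfolding piece_def by metis
  show "piece g i x \<in> tris" "piece g ?j (antipode x) \<in> tris"
    unfolding piece_def using tris_intros(1,2)[OF g] i j(1) edge(1) by simp_all
  fix t assume "t \<in> tris"
  then show "\<iota> g ` ?e \<subseteq> t \<longleftrightarrow> t = piece g i x \<or> t = piece g ?j (antipode x)"
  proof (cases rule: tris_cases)
    case (face h k)
    have "\<iota> g ` ?e \<subseteq> t \<longleftrightarrow> h = g \<and> ?e \<subseteq> tP k"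
      unfolding face(4) image_subset_iff mem_triangles using ne by blast
    also have "\<dots> \<longleftrightarrow> h = g \<and> (k = i \<or> k = ?j)" using edge(3)[OF face(2)] by blast
    finally have 1: "\<iota> g ` ?e \<subseteq> t \<longleftrightarrow> h = g \<and> (k = i \<or> k = ?j)" .
    show ?thesis
    proof
      assume "\<iota> g ` ?e \<subseteq> t"
      then show "t = piece g i x \<or> t = piece g ?j (antipode x)"
        using 1 face unfolding piece_def by auto
    next
      assume "t = piece g i x \<or> t = piece g ?j (antipode x)"
      then show "\<iota> g ` ?e \<subseteq> t" using piece_contains[OF i(2)] piece_contains[OF edge(1)] edge(2) by metis
    qed
  next
    case (near h k y)
    have k: "k \<in> {1..8}" using end_label near by blast
    have "\<iota> g ` ?e \<subseteq> t \<longleftrightarrow> h = g \<and> ?e \<subseteq> tP k - {y}"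
      unfolding near(4) image_subset_iff mem_triangles using ne by blast
    also have "\<dots> \<longleftrightarrow> h = g \<and> tP k - {y} = ?e"
    proof -
      have "card (tP k - {y}) = 2" using card_tP[OF k] near(3) by (simp add: card_Diff_singleton)
      then have "?e \<subseteq> tP k - {y} \<longleftrightarrow> tP k - {y} = ?e"
        using card_e card_tP[OF k] by (metis card_subset_eq finite_Diff subset_refl)
      then show ?thesis by simp
    qed
    finally have 1: "\<iota> g ` ?e \<subseteq> t \<longleftrightarrow> h = g \<and> tP k - {y} = ?e" .
    show ?thesis
    proof
      assume "\<iota> g ` ?e \<subseteq> t"
      then have 2: "h = g" "tP k - {y} = ?e" using 1 by auto
      then have "k = i \<or> k = ?j" using edge(3)[OF k] by blast
      then show "t = piece g i x \<or> t = piece g ?j (antipode x)"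
      proof
        assume "k = i"
        then have "y = x" using 2 i(2) near(3) by blast
        then show ?thesis using near 2 \<open>k = i\<close> unfolding piece_def by simp
      next
        assume "k = ?j"
        then have "y = antipode x" using 2 edge(1,2) near(3) by blast
        then show ?thesis using near 2 \<open>k = ?j\<close> unfolding piece_def by simp
      qed
    next
      assume "t = piece g i x \<or> t = piece g ?j (antipode x)"
      then show "\<iota> g ` ?e \<subseteq> t" using piece_contains[OF i(2)] piece_contains[OF edge(1)] edge(2) by metis
    qed
  next
    case (far h k y)
    have "\<not> \<iota> g ` ?e \<subseteq> t"
    proof
      assume "\<iota> g ` ?e \<subseteq> t"
      then have "?e \<subseteq> {y}" unfolding far(4) image_subset_iff mem_triangles by blast
      then show False using not1 by blast
    qed
    moreover have "\<iota> g ` ?e \<subseteq> piece g i x" "\<iota> g ` ?e \<subseteq> piece g ?j (antipode x)"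
      using piece_contains[OF i(2)] piece_contains[OF edge(1)] edge(2) by metis+
    ultimately show ?thesis by metis
  qed
qed

text \<open>
  The edges between the two ends of a tunnel link near and far sides into a cycle of length six, in
  which the near side at \<open>x\<close> is adjacent to the far sides at the two other vertices.
\<close>

lemma cover_cross_edge:
  assumes g: "g \<in> G" and k: "k \<in> E g" and xy: "x \<in> tP k" "y \<in> tP k" "x \<noteq> y"
    and M: "M \<subseteq> tris"
  shows "(\<exists>!t. t \<in> M \<and> {\<iota> g y, p g k (\<tau> g k x)} \<subseteq> t) \<longleftrightarrow> (near g k x \<in> M \<longleftrightarrow> far g k y \<notin> M)"
proof (rule ex1_iff_xor[OF M])
  have inj: "\<tau> g k u = \<tau> g k v \<longleftrightarrow> u = v" if "u \<in> tP k" "v \<in> tP k" for u v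
    using twist[OF g k] that unfolding bij_betw_def by (meson inj_on_eq_iff)
  obtain z where z: "z \<in> tP k" "z \<noteq> x" "z \<noteq> y"
    using tP_third_vertex[OF end_label(1)[OF g k] xy] by (metis insert_iff)
  show "near g k x \<noteq> far g k y"
    using z mem_triangles(2)[of g z g k x] mem_triangles(3)[of g z g k y] by metis
  show "near g k x \<in> tris" "far g k y \<in> tris" using tris_intros[OF g] k xy by blast+
  fix t assume "t \<in> tris"
  then show "{\<iota> g y, p g k (\<tau> g k x)} \<subseteq> t \<longleftrightarrow> t = near g k x \<or> t = far g k y"
  proof (cases rule: tris_cases)
    case (face h i)
    have "p g k (\<tau> g k x) \<in> near g k x" "p g k (\<tau> g k x) \<in> far g k y"
      using xy by auto
    moreover have "p g k (\<tau> g k x) \<notin> t" using face by simp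
    ultimately show ?thesis by blast
  next
    case (near h l u)
    show ?thesis
    proof
      assume "{\<iota> g y, p g k (\<tau> g k x)} \<subseteq> t"
      then have h: "h = g" "y \<in> tP l" "p g k = p g l" "\<tau> g k x = \<tau> h l u"
        using near by auto
      then have "k = l" using inj_hub[OF g] k near(2) by (metis inj_onD)
      then show "t = near g k x \<or> t = far g k y" using h near inj xy by metis
    next
      assume "t = near g k x \<or> t = far g k y"
      then show "{\<iota> g y, p g k (\<tau> g k x)} \<subseteq> t" using xy by auto
    qed
  next
    case (far h l u)
    show ?thesis
    proof
      assume "{\<iota> g y, p g k (\<tau> g k x)} \<subseteq> t"
      then have h: "h = g" "y = u" "p g k = p g l"
        using far by auto
      then have "k = l" using inj_hub[OF g] k far(2) by (metis inj_onD)
      then show "t = near g k x \<or> t = far g k y" using h far by metis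
    next
      assume "t = near g k x \<or> t = far g k y"
      then show "{\<iota> g y, p g k (\<tau> g k x)} \<subseteq> t" using xy by auto
    qed
  qed
qed

text \<open>
  Only the hubs are shared between copies: the edge of a hub opposite to the corner \<open>c\<close> lies in one
  far side for each tunnel that ends at this hub.
\<close>

lemma contains_hub_edge:
  assumes t: "t \<in> tris"
  shows "p g k ` (- {c}) \<subseteq> t \<longleftrightarrow>
    (\<exists>h\<in>G. \<exists>l\<in>E h. \<exists>y\<in>tP l. p h l = p g k \<and> \<tau> h l y = c \<and> t = far h l y)" (is "_ \<longleftrightarrow> ?R")
proof
  obtain d d' where d: "d \<noteq> c" "d' \<noteq> c" "d \<noteq> d'"
    by (cases c) (use corner.distinct in blast)+
  assume sub: "p g k ` (- {c}) \<subseteq> t"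
  then have dt: "p g k d \<in> t" "p g k d' \<in> t" using d by blast+
  from t show ?R
  proof (cases rule: tris_cases)
    case (face h i)
    then show ?thesis using dt by simp
  next
    case (near h l u)
    then show ?thesis using dt d by simp
  next
    case (far h l u)
    then have eq: "p g k = p h l" using dt by simp
    have "- {c} \<subseteq> - {\<tau> h l u}"
      using sub unfolding far(4) image_subset_iff mem_triangles twist_remove[OF far(1-3)] by blast
    then have "\<tau> h l u = c" by blast
    then show ?thesis using far eq by metis
  qed
next
  assume ?R
  then obtain h l y where *: "h \<in> G" "l \<in> E h" "y \<in> tP l" "p h l = p g k" "\<tau> h l y = c" "t = far h l y"
    by blast
  then show "p g k ` (- {c}) \<subseteq> t"
    unfolding image_subset_iff *(6) mem_triangles twist_remove[OF *(1-3)] by simp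
qed

lemma edge_cases:
  assumes "t \<in> tris" "e \<in> edges_of t"
  obtains (octa) g i x where "g \<in> G" "i \<in> {1..8}" "x \<in> tP i" "e = \<iota> g ` (tP i - {x})"
    | (cross) g k x y where "g \<in> G" "k \<in> E g" "x \<in> tP k" "y \<in> tP k" "x \<noteq> y"
        "e = {\<iota> g y, p g k (\<tau> g k x)}"
    | (hub) g k c where "g \<in> G" "k \<in> E g" "e = p g k ` (- {c})"
proof -
  obtain v where v: "v \<in> t" "e = t - {v}"
    using assms edges_of_triangle[OF card_tris[OF assms(1)]] by blast
  have im: "\<iota> g ` X - {\<iota> g y} = \<iota> g ` (X - {y})" "p g k ` Y - {p g k c} = p g k ` (Y - {c})"
    for g X y k Y c by auto
  show thesis using assms(1)
  proof (cases rule: tris_cases)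
    case (face g i)
    then obtain y where "y \<in> tP i" "v = \<iota> g y" using v(1) unfolding face_def by blast
    then show thesis using octa[of g i y] face v(2) im unfolding face_def by simp
  next
    case (near g k x)
    note k = end_label(1)[OF near(1,2)]
    show thesis
    proof (cases "v = p g k (\<tau> g k x)")
      case True
      then have "e = \<iota> g ` (tP k - {x})" using near(4) v(2) unfolding near_def by auto
      then show thesis using octa near k by blast
    next
      case False
      then obtain y where y: "y \<in> tP k" "y \<noteq> x" "v = \<iota> g y"
        using v(1) near(4) unfolding near_def by blast
      obtain z where z: "tP k = {x, y, z}" "x \<noteq> z" "y \<noteq> z"
        using tP_third_vertex[OF k near(3) y(1)] y(2) by blast
      have "e = {\<iota> g z, p g k (\<tau> g k x)}"
        using near(4) v(2) y z unfolding near_def by auto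
      then show thesis using cross[OF near(1,2,3) _ z(2)] z(1) by simp
    qed
  next
    case (far g k x)
    note k = end_label(1)[OF far(1,2)]
    show thesis
    proof (cases "v = \<iota> g x")
      case True
      then have "e = p g k ` \<tau> g k ` (tP k - {x})" using far(4) v(2) unfolding far_def by auto
      then show thesis using hub far twist_remove[OF far(1-3)] by metis
    next
      case False
      then obtain y where y: "y \<in> tP k" "y \<noteq> x" "v = p g k (\<tau> g k y)"
        using v(1) far(4) unfolding far_def by blast
      obtain z where z: "tP k = {x, y, z}" "x \<noteq> z" "y \<noteq> z"
        using tP_third_vertex[OF k far(3) y(1)] y(2) by blast
      have "\<tau> g k y \<noteq> \<tau> g k z"
        using z twist[OF far(1,2)] unfolding bij_betw_def by (metis inj_on_eq_iff insert_iff)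
      then have "e = {\<iota> g x, p g k (\<tau> g k z)}"
        using far(4) v(2) y z unfolding far_def by auto
      then show thesis using cross[OF far(1,2) _ far(3) z(2)[symmetric]] z(1) by simp
    qed
  qed
qed

text \<open>
  Every edge is an edge of an octahedron, a cross edge of a tunnel or an edge of a hub, so an exact
  cover is described by three local conditions.
\<close>

lemma cover_iff:
  assumes M: "M \<subseteq> tris"
  shows "(\<forall>t\<in>tris. \<forall>e\<in>edges_of t. \<exists>!u. u \<in> M \<and> e \<subseteq> u) \<longleftrightarrow>
    (\<forall>g\<in>G. \<forall>i\<in>{1..8}. \<forall>x\<in>tP i.
       piece g i x \<in> M \<longleftrightarrow> piece g (neighbour_label x i) (antipode x) \<notin> M) \<and>
    (\<forall>g\<in>G. \<forall>k\<in>E g. \<forall>x\<in>tP k. \<forall>y\<in>tP k. x \<noteq> y \<longrightarrow> (near g k x \<in> M \<longleftrightarrow> far g k y \<notin> M)) \<and>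
    (\<forall>g\<in>G. \<forall>k\<in>E g. \<forall>c. \<exists>!u. u \<in> M \<and> p g k ` (- {c}) \<subseteq> u)"
    (is "?cover \<longleftrightarrow> ?octa \<and> ?cross \<and> ?hub")
proof
  assume cover: ?cover
  have sub: "\<exists>!u. u \<in> M \<and> e \<subseteq> u" if "t \<in> tris" "e \<subseteq> t" "card e = 2" for t e
  proof -
    have "e \<in> edges_of t" unfolding edges_of_def using that by simp
    moreover have "\<forall>e\<in>edges_of t. \<exists>!u. u \<in> M \<and> e \<subseteq> u" using cover that(1) by (rule bspec)
    ultimately show ?thesis by (rule bspec[rotated])
  qed
  have ?octa
  proof (intro ballI)
    fix g i x assume *: "g \<in> G" "i \<in> {1..8}" "x \<in> tP i"
    have "piece g i x \<in> tris" using tris_intros(1,2)[OF *(1)] * unfolding piece_def by auto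
    then have "\<exists>!u. u \<in> M \<and> \<iota> g ` (tP i - {x}) \<subseteq> u"
      using piece_contains[OF *(3)] card_octa_edge[OF *(2,3)] by (rule sub)
    then show "piece g i x \<in> M \<longleftrightarrow> piece g (neighbour_label x i) (antipode x) \<notin> M"
      using cover_octa_edge[OF * M] by (rule iffD1[rotated])
  qed
  moreover have ?cross
  proof (intro ballI impI)
    fix g k x y assume *: "g \<in> G" "k \<in> E g" "x \<in> tP k" "y \<in> tP k" "x \<noteq> y"
    have "near g k x \<in> tris" using tris_intros(2) * by blast
    moreover have "{\<iota> g y, p g k (\<tau> g k x)} \<subseteq> near g k x" using * by auto
    moreover have "card {\<iota> g y, p g k (\<tau> g k x)} = 2" by simp
    ultimately have "\<exists>!u. u \<in> M \<and> {\<iota> g y, p g k (\<tau> g k x)} \<subseteq> u" by (intro sub)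
    then show "near g k x \<in> M \<longleftrightarrow> far g k y \<notin> M"
      using cover_cross_edge[OF * M] by (rule iffD1[rotated])
  qed
  moreover have ?hub
  proof (intro ballI allI)
    fix g k c assume *: "g \<in> G" "k \<in> E g"
    obtain x where x: "x \<in> tP k" "\<tau> g k x = c"
      using twist[OF *] unfolding bij_betw_def by (metis UNIV_I imageE)
    have "far g k x \<in> tris" using tris_intros(3) * x by blast
    moreover from this have "p g k ` (- {c}) \<subseteq> far g k x" using contains_hub_edge * x by blast
    ultimately show "\<exists>!u. u \<in> M \<and> p g k ` (- {c}) \<subseteq> u"
      using card_hub_edge by (rule sub)
  qed
  ultimately show "?octa \<and> ?cross \<and> ?hub" by (intro conjI)
next
  assume "?octa \<and> ?cross \<and> ?hub"
  then have o: ?octa and c: ?cross and h: ?hub by simp_all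
  show ?cover
  proof (intro ballI)
    fix t e assume "t \<in> tris" "e \<in> edges_of t"
    then show "\<exists>!u. u \<in> M \<and> e \<subseteq> u"
    proof (cases rule: edge_cases)
      case (octa g i x)
      show ?thesis unfolding octa(4) cover_octa_edge[OF octa(1-3) M] using o octa(1-3) by simp
    next
      case (cross g k x y)
      show ?thesis unfolding cross(6) cover_cross_edge[OF cross(1-5) M] using c cross(1-5) by simp
    next
      case (hub g k c)
      show ?thesis unfolding hub(3) using h hub(1,2) by simp
    qed
  qed
qed

section \<open>The two states of a copy\<close>

definition select :: "'g set \<Rightarrow> 'v set set" where
  "select A = (\<Union>g\<in>G. if g \<in> A then on g else off g)"

text \<open>
  The condition that the hubs impose on the set \<open>A\<close> of copies in state \<open>on\<close>.
\<close>

definition exact_hub_cover :: "'g set \<Rightarrow> bool" where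
  "exact_hub_cover A \<longleftrightarrow> A \<subseteq> G \<and> (\<forall>g\<in>G. \<forall>k\<in>E g. \<exists>!h. h \<in> A \<and> p g k \<in> p h ` E h)"

lemma face_eq: "i \<in> {1..8} \<Longrightarrow> j \<in> {1..8} \<Longrightarrow> face g i = face h j \<Longrightarrow> g = h \<and> i = j"
proof -
  assume i: "i \<in> {1..8}" and j: "j \<in> {1..8}" and eq: "face g i = face h j"
  have "tP i \<noteq> {}" using card_tP[OF i] by auto
  then obtain x where "x \<in> tP i" by blast
  then have gh: "g = h" using eq mem_triangles(1)[of g x g i] mem_triangles(1)[of g x h j] by metis
  have "inj (\<iota> g)" by (rule injI) simp
  then have "tP i = tP j" using eq gh unfolding face_def by (simp add: inj_image_eq_iff)
  then show ?thesis using gh inj_on_tP i j by (meson inj_onD)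
qed

lemma face_neq_near: "face g i \<noteq> near h k x"
  using mem_triangles(4)[of h k "\<tau> h k x" g i] mem_triangles(5)[of h k "\<tau> h k x" h k x] by metis

lemma near_neq_far:
  assumes "k \<in> {1..8}" "x \<in> tP k"
  shows "near g k x \<noteq> far h l y"
proof
  assume eq: "near g k x = far h l y"
  have "card (tP k - {x}) = 2" using card_tP[OF assms(1)] assms(2) by simp
  then obtain a b where "tP k - {x} = {a, b}" "a \<noteq> b" unfolding card_2_iff by blast
  then have "\<iota> g a \<in> near g k x" "\<iota> g b \<in> near g k x" "a \<noteq> b" by auto
  then show False unfolding eq by simp
qed

lemma face_neq_far:
  assumes "k \<in> {1..8}"
  shows "face g i \<noteq> far h k x"
proof
  assume eq: "face g i = far h k x"
  obtain y where "y \<in> tP k" "y \<noteq> x" using tP_other_vertex[OF assms] .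
  then have "p h k (\<tau> h k y) \<in> far h k x" by simp
  then show False unfolding eq[symmetric] by simp
qed

text \<open>
  Being disjoint, the two states can be told apart by any triangle of either.
\<close>

lemma on_off_disjoint:
  assumes g: "g \<in> G"
  shows "on g \<inter> off g = {}"
proof -
  have "t \<noteq> u" if "t \<in> on g" "u \<in> off g" for t u
  proof -
    have "t \<in> face g ` {2, 4, 6, 8} \<or> (\<exists>k\<in>E g. t \<in> far g k ` tP k)"
      "u \<in> face g ` ({1, 3, 5, 7} - E g) \<or> (\<exists>k\<in>E g. u \<in> near g k ` tP k)"
      using that unfolding on_def off_def by simp_all
    then show ?thesis
    proof (elim disjE bexE imageE)
      fix i j assume *: "t = face g i" "i \<in> {2, 4, 6, 8}" "u = face g j" "j \<in> {1, 3, 5, 7} - E g"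
      then have "i \<in> {1..8}" "j \<in> {1..8}" "i \<noteq> j" by auto
      then show ?thesis using face_eq * by metis
    next
      fix i k x assume "t = face g i" "u = near g k x"
      then show ?thesis using face_neq_near by simp
    next
      fix j k x assume "k \<in> E g" "t = far g k x" "u = face g j"
      then show ?thesis using face_neq_far end_label[OF g] by metis
    next
      fix k x l y assume "t = far g k x" "l \<in> E g" "y \<in> tP l" "u = near g l y"
      then show ?thesis using near_neq_far end_label[OF g] by metis
    qed
  qed
  then show ?thesis by blast
qed

lemma copy_unique:
  assumes "g \<in> G" "h \<in> G" "t \<in> on g \<union> off g" "t \<in> on h \<union> off h"
  shows "g = h"
proof -
  have copy: "(\<exists>y. \<iota> f y \<in> t) \<and> (\<forall>f' y. \<iota> f' y \<in> t \<longrightarrow> f' = f)"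
    if f: "f \<in> G" "t \<in> on f \<union> off f" for f
  proof -
    have ne: "\<exists>y. y \<in> tP i \<and> y \<noteq> x" if "i \<in> {1..8}" for i x
      using tP_other_vertex[OF that] by metis
    have "t \<in> face f ` ({1..8} - E f) \<or> (\<exists>k\<in>E f. t \<in> near f k ` tP k \<or> t \<in> far f k ` tP k)"
      using f(2) unfolding on_Un_off[OF f(1)] by simp
    then show ?thesis
    proof (elim disjE bexE imageE DiffE)
      show ?thesis if "i \<in> {1..8}" "t = face f i" for i
        using ne[OF that(1)] unfolding that(2) mem_triangles by blast
      show ?thesis if "k \<in> E f" "t = near f k x" for k x
        using ne[OF end_label(1)[OF f(1) that(1)]] unfolding that(2) mem_triangles by blast
      show ?thesis if "t = far f k x" for k x
        unfolding that mem_triangles by blast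
    qed
  qed
  then show ?thesis using assms by metis
qed

lemma select_Int:
  assumes g: "g \<in> G"
  shows "select A \<inter> (on g \<union> off g) = (if g \<in> A then on g else off g)"
proof
  show "select A \<inter> (on g \<union> off g) \<subseteq> (if g \<in> A then on g else off g)"
  proof
    fix t assume t: "t \<in> select A \<inter> (on g \<union> off g)"
    then obtain h where h: "h \<in> G" "t \<in> (if h \<in> A then on h else off h)"
      unfolding select_def by blast
    then have "t \<in> on h \<union> off h" by (metis UnCI)
    then have "g = h" using copy_unique g h(1) t by blast
    then show "t \<in> (if g \<in> A then on g else off g)" using h(2) by metis
  qed
  show "(if g \<in> A then on g else off g) \<subseteq> select A \<inter> (on g \<union> off g)"
    unfolding select_def using g by auto
qed

lemma mem_select:
  assumes g: "g \<in> G"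
  shows "t \<in> on g \<Longrightarrow> t \<in> select A \<longleftrightarrow> g \<in> A"
    and "t \<in> off g \<Longrightarrow> t \<in> select A \<longleftrightarrow> g \<notin> A"
  using select_Int[OF g, of A] on_off_disjoint[OF g] by (auto split: if_splits)

lemma select_subset: "select A \<subseteq> tris"
  unfolding select_def tris_def by auto

lemma select_pieces:
  assumes g: "g \<in> G"
  shows "k \<in> E g \<Longrightarrow> x \<in> tP k \<Longrightarrow> far g k x \<in> select A \<longleftrightarrow> g \<in> A"
    and "k \<in> E g \<Longrightarrow> x \<in> tP k \<Longrightarrow> near g k x \<in> select A \<longleftrightarrow> g \<notin> A"
    and "i \<in> {1..8} \<Longrightarrow> x \<in> tP i \<Longrightarrow> piece g i x \<in> select A \<longleftrightarrow> (even i \<longleftrightarrow> g \<in> A)"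
proof -
  show "far g k x \<in> select A \<longleftrightarrow> g \<in> A" if "k \<in> E g" "x \<in> tP k"
    by (rule mem_select(1)[OF g]) (use that in \<open>auto simp: on_def\<close>)
  show near: "near g k x \<in> select A \<longleftrightarrow> g \<notin> A" if "k \<in> E g" "x \<in> tP k" for k
    by (rule mem_select(2)[OF g]) (use that in \<open>auto simp: off_def\<close>)
  show "piece g i x \<in> select A \<longleftrightarrow> (even i \<longleftrightarrow> g \<in> A)" if i: "i \<in> {1..8}" "x \<in> tP i"
  proof (cases "i \<in> E g")
    case True
    then show ?thesis using near i(2) end_label[OF g] unfolding piece_def by simp
  next
    case False
    have "(even i \<and> i \<in> {2, 4, 6, 8}) \<or> (odd i \<and> i \<in> {1, 3, 5, 7})"
      using i(1) unfolding labels_eq by auto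
    then have "even i \<and> face g i \<in> on g \<or> odd i \<and> face g i \<in> off g"
      using False unfolding on_def off_def by blast
    then show ?thesis using False mem_select[OF g] unfolding piece_def by auto
  qed
qed

text \<open>
  Away from the hubs a copy has no more than the two states. By the alternating cycle of cross edges,
  either all near or all far sides of a tunnel are selected, so each removed triangle behaves like one
  that is selected or not. Adjacency of the eight octahedron triangles is the graph of the cube, which
  is connected and bipartite by the parity of labels; since of two adjacent triangles exactly one is
  selected, the selected ones are those with even labels or those with odd labels.
  The triangle \<open>tP 2\<close> is never removed and tells which case holds.
\<close>

lemma local_constraints_imp_select:
  assumes M: "M \<subseteq> tris"
    and octa: "\<And>g i x. g \<in> G \<Longrightarrow> i \<in> {1..8} \<Longrightarrow> x \<in> tP i \<Longrightarrow>
       piece g i x \<in> M \<longleftrightarrow> piece g (neighbour_label x i) (antipode x) \<notin> M"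
    and cross: "\<And>g k x y. g \<in> G \<Longrightarrow> k \<in> E g \<Longrightarrow> x \<in> tP k \<Longrightarrow> y \<in> tP k \<Longrightarrow> x \<noteq> y \<Longrightarrow>
       near g k x \<in> M \<longleftrightarrow> far g k y \<notin> M"
  shows "M = select {g \<in> G. face g 2 \<in> M}"
proof -
  let ?A = "{g \<in> G. face g 2 \<in> M}"
  have const: "piece g i x \<in> M \<longleftrightarrow> piece g i y \<in> M"
    if i: "g \<in> G" "i \<in> {1..8}" "x \<in> tP i" "y \<in> tP i" for g i x y
  proof (cases "x = y \<or> i \<notin> E g")
    case True
    then show ?thesis unfolding piece_def by auto
  next
    case False
    then obtain z where z: "tP i = {x, y, z}" "x \<noteq> z" "y \<noteq> z"
      using tP_third_vertex i(2-4) by metis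
    then show ?thesis using False i cross[of g i x z] cross[of g i y z] unfolding piece_def by simp
  qed
  have parity: "piece g i x \<in> M \<longleftrightarrow> (even i \<longleftrightarrow> g \<in> ?A)"
    if g: "g \<in> G" and i: "i \<in> {1..8}" "x \<in> tP i" for g i x
  proof -
    \<comment> \<open>the common membership of the pieces at \<open>tP i\<close>, as \<open>const\<close> shows\<close>
    define V where "V i \<longleftrightarrow> (\<forall>x\<in>tP i. piece g i x \<in> M)" for i
    have V: "piece g i x \<in> M \<longleftrightarrow> V i" if "i \<in> {1..8}" "x \<in> tP i" for i x
      using const[OF g] that unfolding V_def by blast
    have flip: "V (neighbour_label z i) \<longleftrightarrow> \<not> V i" if "i \<in> {1..8}" "z \<in> tP i" for z i
      using octa[OF g that] V that neighbour_label(1) octahedron_edge(1) by metis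
    \<comment> \<open>a spanning tree of the cube, rooted at label 2\<close>
    have "V 3 \<longleftrightarrow> \<not> V 2" "V 5 \<longleftrightarrow> \<not> V 2" "V 7 \<longleftrightarrow> \<not> V 2" "V 6 \<longleftrightarrow> \<not> V 3" "V 8 \<longleftrightarrow> \<not> V 3"
      "V 4 \<longleftrightarrow> \<not> V 5" "V 1 \<longleftrightarrow> \<not> V 4"
      using flip[of 2 Xm] flip[of 2 Ym] flip[of 2 Zm] flip[of 3 Zm] flip[of 3 Ym]
        flip[of 5 Zm] flip[of 4 Xm] by (simp_all add: tP_def neighbour_label_def)
    then have "V i \<longleftrightarrow> (even i \<longleftrightarrow> V 2)"
      using i(1) unfolding labels_eq by (elim insertE emptyE) simp_all
    moreover have "2 \<notin> E g" using ends[OF g] by auto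
    then have "V 2 \<longleftrightarrow> g \<in> ?A"
      using g card_tP[of 2] unfolding V_def piece_def by (auto simp: tP_def)
    ultimately show ?thesis using V i by simp
  qed
  have far_mem: "far g k x \<in> M \<longleftrightarrow> g \<in> ?A" if g: "g \<in> G" and k: "k \<in> E g" "x \<in> tP k" for g k x
  proof -
    note lab = end_label[OF g k(1)]
    obtain y where y: "y \<in> tP k" "y \<noteq> x" using tP_other_vertex[OF lab(1)] .
    then have "near g k y \<in> M \<longleftrightarrow> far g k x \<notin> M" using cross g k by blast
    moreover have "near g k y \<in> M \<longleftrightarrow> g \<notin> ?A"
      using parity[OF g lab(1) y(1)] k lab(2) unfolding piece_def by simp
    ultimately show ?thesis by blast
  qed
  have "t \<in> M \<longleftrightarrow> t \<in> select ?A" if "t \<in> tris" for t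
    using that
  proof (cases rule: tris_cases)
    case (face g i)
    obtain x where x: "x \<in> tP i" using card_tP[OF face(2)] by fastforce
    then show ?thesis
      using face parity[OF face(1,2) x] select_pieces(3)[OF face(1,2) x] unfolding piece_def by simp
  next
    case (near g k x)
    note lab = end_label(1)[OF near(1,2)]
    show ?thesis
      using near parity[OF near(1) lab near(3)] select_pieces(3)[OF near(1) lab near(3)]
      unfolding piece_def by simp
  next
    case (far g k x)
    then show ?thesis using far_mem[OF far(1-3)] select_pieces(1)[OF far(1-3)] by simp
  qed
  then show ?thesis using M select_subset by blast
qed

text \<open>
  A copy in state \<open>on\<close> with a tunnel to the hub contributes exactly one far side at each edge of the
  hub, and copies in state \<open>off\<close> contribute none.
\<close>

lemma hub_cover_select:
  assumes A: "A \<subseteq> G" and g: "g \<in> G" "k \<in> E g"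
  shows "(\<exists>!u. u \<in> select A \<and> p g k ` (- {c}) \<subseteq> u) \<longleftrightarrow> (\<exists>!h. h \<in> A \<and> p g k \<in> p h ` E h)"
proof -
  define Q where "Q h \<longleftrightarrow> h \<in> A \<and> p g k \<in> p h ` E h" for h
  define P where "P h u \<longleftrightarrow> (\<exists>l\<in>E h. \<exists>y\<in>tP l. p h l = p g k \<and> \<tau> h l y = c \<and> u = far h l y)" for h u
  have ex: "\<exists>u. P h u" if Qh: "Q h" for h
  proof -
    obtain l where l: "l \<in> E h" "p h l = p g k" "h \<in> G" using Qh A unfolding Q_def by auto
    then obtain y where "y \<in> tP l" "\<tau> h l y = c"
      using twist[of h l] unfolding bij_betw_def by (metis UNIV_I imageE)
    then show ?thesis using l unfolding P_def by blast
  qed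
  have uniq: "u = u'" if Qh: "Q h" "P h u" "P h u'" for h u u'
  proof -
    have h: "h \<in> G" using Qh A unfolding Q_def by blast
    obtain l y where 1: "l \<in> E h" "y \<in> tP l" "p h l = p g k" "\<tau> h l y = c" "u = far h l y"
      using Qh(2) unfolding P_def by blast
    obtain l' y' where 2: "l' \<in> E h" "y' \<in> tP l'" "p h l' = p g k" "\<tau> h l' y' = c" "u' = far h l' y'"
      using Qh(3) unfolding P_def by blast
    have l: "l = l'" using inj_hub[OF h] 1(1,3) 2(1,3) by (metis inj_onD)
    then have "y = y'" using twist[OF h 1(1)] 1(2,4) 2(2,4) unfolding bij_betw_def by (metis inj_onD)
    then show ?thesis using l 1 2 by simp
  qed
  have sep: "h = h'" if Ph: "P h u" "P h' u" for h h' u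
  proof -
    obtain l y where u: "u = far h l y" using Ph(1) unfolding P_def by blast
    obtain l' y' where u': "u = far h' l' y'" using Ph(2) unfolding P_def by blast
    have "\<iota> h y \<in> far h' l' y'" using u u' mem_triangles(3)[of h y h l y] by simp
    then show ?thesis by simp
  qed
  have iff: "u \<in> select A \<and> p g k ` (- {c}) \<subseteq> u \<longleftrightarrow> (\<exists>h. Q h \<and> P h u)" for u
  proof
    assume u: "u \<in> select A \<and> p g k ` (- {c}) \<subseteq> u"
    then have "u \<in> tris" using select_subset by blast
    from contains_hub_edge[OF this, of g k c] u obtain h l y where *: "h \<in> G" "l \<in> E h" "y \<in> tP l" "p h l = p g k" "\<tau> h l y = c" "u = far h l y"
      by blast
    then have "h \<in> A" using select_pieces(1) u by blast
    then show "\<exists>h. Q h \<and> P h u" using * unfolding Q_def P_def by (metis imageI)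
  next
    assume "\<exists>h. Q h \<and> P h u"
    then obtain h l y where *: "h \<in> A" "l \<in> E h" "y \<in> tP l" "p h l = p g k" "\<tau> h l y = c" "u = far h l y"
      unfolding Q_def P_def by blast
    then have "u \<in> select A" using select_pieces(1) A by blast
    moreover from this have "u \<in> tris" using select_subset by blast
    from contains_hub_edge[OF this, of g k c] have "p g k ` (- {c}) \<subseteq> u" using * A by blast
    ultimately show "u \<in> select A \<and> p g k ` (- {c}) \<subseteq> u" by blast
  qed
  have "(\<exists>!u. \<exists>h. Q h \<and> P h u) \<longleftrightarrow> (\<exists>!h. Q h)"
    using ex uniq sep by metis
  then show ?thesis unfolding iff Q_def .
qed

text \<open>
  This removes all geometry: what is left of a perfect matching is a choice of copies covering
  each hub once.
\<close>

lemma perfect_matching_iff_select: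
  "perfect_matching (\<Union>g\<in>G. gadget (\<iota> g) (\<tau> g) (E g) (p g)) M \<longleftrightarrow> (\<exists>A. exact_hub_cover A \<and> M = select A)"
proof -
  have pm: "perfect_matching (\<Union>g\<in>G. gadget (\<iota> g) (\<tau> g) (E g) (p g)) M \<longleftrightarrow>
      M \<subseteq> tris \<and> (\<forall>t\<in>tris. \<forall>e\<in>edges_of t. \<exists>!u. u \<in> M \<and> e \<subseteq> u)"
    unfolding union_gadgets_eq using card_tris by (intro perfect_matching_generated_cpx) blast
  show ?thesis
  proof
    assume "perfect_matching (\<Union>g\<in>G. gadget (\<iota> g) (\<tau> g) (E g) (p g)) M"
    then have M: "M \<subseteq> tris" and "\<forall>t\<in>tris. \<forall>e\<in>edges_of t. \<exists>!u. u \<in> M \<and> e \<subseteq> u"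
      unfolding pm by auto
    note constr = this(2)[unfolded cover_iff[OF M]]
    let ?A = "{g \<in> G. face g 2 \<in> M}"
    have eq: "M = select ?A"
      by (rule local_constraints_imp_select[OF M]) (use constr in blast)+
    have "exact_hub_cover ?A"
      unfolding exact_hub_cover_def
    proof (intro conjI ballI)
      fix g k assume g: "g \<in> G" "k \<in> E g"
      have "\<exists>!u. u \<in> M \<and> p g k ` (- {C1}) \<subseteq> u" using constr g by blast
      then have "\<exists>!u. u \<in> select ?A \<and> p g k ` (- {C1}) \<subseteq> u" using eq by simp
      then show "\<exists>!h. h \<in> ?A \<and> p g k \<in> p h ` E h"
        using hub_cover_select[of ?A g k C1] g by simp
    qed simp
    then show "\<exists>A. exact_hub_cover A \<and> M = select A" using eq by blast
  next
    assume "\<exists>A. exact_hub_cover A \<and> M = select A"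
    then obtain A where A: "exact_hub_cover A" "M = select A" by blast
    have AG: "A \<subseteq> G" using A(1) unfolding exact_hub_cover_def by blast
    have M: "M \<subseteq> tris" using A(2) select_subset by simp
    show "perfect_matching (\<Union>g\<in>G. gadget (\<iota> g) (\<tau> g) (E g) (p g)) M"
      unfolding pm cover_iff[OF M]
    proof (intro conjI ballI allI impI M)
      fix g i x assume *: "g \<in> G" "i \<in> {1..8}" "x \<in> tP i"
      show "piece g i x \<in> M \<longleftrightarrow> piece g (neighbour_label x i) (antipode x) \<notin> M"
        using select_pieces(3)[OF *] neighbour_label[OF *(2), of x]
          select_pieces(3)[OF *(1) neighbour_label(1)[OF *(2)] octahedron_edge(1)[OF *(2,3)]]
        unfolding A(2) by blast
    next
      fix g k x y assume "g \<in> G" "k \<in> E g" "x \<in> tP k" "y \<in> tP k"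
      then show "near g k x \<in> M \<longleftrightarrow> far g k y \<notin> M" unfolding A(2) using select_pieces(1,2) by metis
    next
      fix g k c assume gk: "g \<in> G" "k \<in> E g"
      have "\<exists>!h. h \<in> A \<and> p g k \<in> p h ` E h" using A(1) gk unfolding exact_hub_cover_def by simp
      then show "\<exists>!u. u \<in> M \<and> p g k ` (- {c}) \<subseteq> u"
        using hub_cover_select[OF AG gk, of c] A(2) by simp
    qed
  qed
qed

lemma share_edge_hub:
  assumes g: "g \<in> G" and k: "k \<in> E g" "x \<in> tP k"
  shows "share_edge (far g k x) (range (p g k))" "\<not> share_edge (near g k x) (range (p g l))"
proof -
  have "p g k ` (- {\<tau> g k x}) \<subseteq> far g k x \<inter> range (p g k)"
    unfolding far_def twist_remove[OF g k] by blast
  then show "share_edge (far g k x) (range (p g k))"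
    using card_hub_edge by (rule share_edgeI)
  show "\<not> share_edge (near g k x) (range (p g l))"
    by (rule inter_not_share_edge[of _ _ "p g k (\<tau> g k x)"]) (auto simp: near_def)
qed

lemma share_edge_octahedron:
  assumes k: "k \<in> {1..8}" "x \<in> tP k"
  shows "share_edge (near g k x) (\<iota> g ` tP k)" "\<not> share_edge (far g k x) (\<iota> g ` tP l)"
proof -
  have "\<iota> g ` (tP k - {x}) \<subseteq> near g k x \<inter> \<iota> g ` tP k"
    unfolding near_def by blast
  then show "share_edge (near g k x) (\<iota> g ` tP k)"
    using card_octa_edge[OF k] by (rule share_edgeI)
  show "\<not> share_edge (far g k x) (\<iota> g ` tP l)"
    by (rule inter_not_share_edge[of _ _ "\<iota> g x"]) (auto simp: far_def)
qed

text \<open>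
  The sides sharing an edge with a hub are the far sides, and those sharing an edge with a removed
  triangle are the near sides, so the prescribed sets \<open>M\<^sup>1\<close> and \<open>M\<^sup>0\<close> are the two states.
\<close>

lemma matching_triangle_eq:
  assumes g: "g \<in> G" "E g = {1, 3, 5}"
  shows "matching_triangle_M1 (\<iota> g) (\<tau> g) (p g 1) (p g 3) (p g 5) = on g"
    and "matching_triangle_M0 (\<iota> g) (\<tau> g) (p g 1) (p g 3) (p g 5) = off g"
proof -
  let ?S = "matching_triangle_sides (\<iota> g) (\<tau> g) (p g 1) (p g 3) (p g 5)"
  have sides: "?S = (\<Union>k\<in>{1, 3, 5}. near g k ` tP k) \<union> (\<Union>k\<in>{1, 3, 5}. far g k ` tP k)"
    unfolding matching_triangle_sides_def oct_tunnel_eq by blast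
  let ?P = "\<lambda>s. share_edge s (range (p g 1)) \<or> share_edge s (range (p g 3)) \<or> share_edge s (range (p g 5))"
  let ?O = "\<lambda>s. share_edge s (\<iota> g ` tP 1) \<or> share_edge s (\<iota> g ` tP 3) \<or> share_edge s (\<iota> g ` tP 5)"
  have near: "\<not> ?P s \<and> ?O s" if s: "s \<in> (\<Union>k\<in>{1, 3, 5}. near g k ` tP k)" for s
  proof -
    obtain k x where k: "k \<in> {1, 3, 5}" "x \<in> tP k" "s = near g k x" using s by blast
    have kE: "k \<in> E g" using k g by simp
    have "share_edge s (\<iota> g ` tP k)"
      using share_edge_octahedron(1)[OF end_label(1)[OF g(1) kE] k(2)] k(3) by simp
    then have "?O s" using k(1) by blast
    then show ?thesis using share_edge_hub(2)[OF g(1) kE k(2)] k(3) by simp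
  qed
  have far: "?P s \<and> \<not> ?O s" if s: "s \<in> (\<Union>k\<in>{1, 3, 5}. far g k ` tP k)" for s
  proof -
    obtain k x where k: "k \<in> {1, 3, 5}" "x \<in> tP k" "s = far g k x" using s by blast
    have kE: "k \<in> E g" using k g by simp
    have "share_edge s (range (p g k))"
      using share_edge_hub(1)[OF g(1) kE k(2)] k(3) by simp
    then have "?P s" using k(1) by blast
    then show ?thesis
      using share_edge_octahedron(2)[OF end_label(1)[OF g(1) kE] k(2)] k(3) by simp
  qed
  have filter: "{s \<in> X \<union> Y. Q s} = Y" "{s \<in> Y \<union> X. Q s} = Y"
    if "\<And>s. s \<in> X \<Longrightarrow> \<not> Q s" "\<And>s. s \<in> Y \<Longrightarrow> Q s" for X Y :: "'v set set" and Q
    using that by blast+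
  have "{s \<in> ?S. ?P s} = (\<Union>k\<in>{1, 3, 5}. far g k ` tP k)"
    unfolding sides by (rule filter(1)) (use near far in simp_all)
  then show "matching_triangle_M1 (\<iota> g) (\<tau> g) (p g 1) (p g 3) (p g 5) = on g"
    unfolding matching_triangle_M1_def on_def g(2) by (simp add: face_def)
  have "{s \<in> ?S. ?O s} = (\<Union>k\<in>{1, 3, 5}. near g k ` tP k)"
    unfolding sides by (rule filter(2)) (use near far in simp_all)
  then show "matching_triangle_M0 (\<iota> g) (\<tau> g) (p g 1) (p g 3) (p g 5) = off g"
    unfolding matching_triangle_M0_def off_def g(2) by (simp add: face_def)
qed

end

section \<open>Parity along a chain of matching edges\<close>

primrec odd_prefix :: "(nat \<Rightarrow> bool) \<Rightarrow> nat \<Rightarrow> bool" where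
  "odd_prefix x 0 = False"
| "odd_prefix x (Suc i) = (odd_prefix x i \<noteq> x (Suc i))"

lemma odd_prefix_iff_card: "odd_prefix x n \<longleftrightarrow> odd (card {i \<in> {1..n}. x i})"
proof (induction n)
  case (Suc n)
  have "{i \<in> {1..Suc n}. x i} = (if x (Suc n) then insert (Suc n) else id) {i \<in> {1..n}. x i}"
    by (auto simp: le_Suc_eq)
  then show ?case using Suc by simp
qed simp

text \<open>
  The conditions imposed at the hubs of one configuration \<open>C\<^bsub>t\<^sub>1\<dots>t\<^sub>n\<^esub>\<close>. The Boolean \<open>x i\<close> is the state
  of the matching triangle of \<open>t\<^sub>i\<close>, while \<open>r i\<close>, \<open>d i\<close> and \<open>l i\<close> are the states of the matching edges
  \<open>Rung i\<close>, \<open>Diag i\<close> and \<open>Rail i\<close>. The first sum belongs to the empty triangle \<open>t\<^sub>i\<close> and the second one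
  to \<open>t\<^sub>i'\<close>; links that do not exist count as \<open>False\<close>.
\<close>

definition parity_chain ::
  "nat \<Rightarrow> (nat \<Rightarrow> bool) \<Rightarrow> (nat \<Rightarrow> bool) \<Rightarrow> (nat \<Rightarrow> bool) \<Rightarrow> (nat \<Rightarrow> bool) \<Rightarrow> bool" where
  "parity_chain n x r d l \<longleftrightarrow>
     (\<forall>i. r i \<longrightarrow> i \<in> {1..n}) \<and> (\<forall>i. d i \<longrightarrow> i \<in> {2..n}) \<and> (\<forall>i. l i \<longrightarrow> i \<in> {1..n - 1}) \<and>
     (\<forall>i\<in>{1..n}. of_bool (x i) + of_bool (r i) + of_bool (d i) = (1::nat)) \<and>
     (\<forall>i\<in>{1..n}. of_bool (r i) + of_bool (d (Suc i)) + of_bool (l i) + of_bool (l (i - 1)) = (1::nat))"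

text \<open>
  The number \<open>d (i + 1) + l i\<close> of selected links that lead from the first \<open>i\<close> positions to later ones is
  0 or 1 and equals the parity of the number of \<open>j \<le> i\<close> with \<open>x j\<close>. No link leaves the last position,
  which forces the total to be even; conversely \<open>x (i + 1)\<close> decides at each position which of the two
  links carries the parity on, so the states of all links are determined.
\<close>

lemma parity_chain_iff:
  "parity_chain n x r d l \<longleftrightarrow>
    \<not> odd_prefix x n \<and>
    (\<forall>i. r i \<longleftrightarrow> i \<in> {1..n} \<and> \<not> odd_prefix x (i - 1) \<and> \<not> x i) \<and>
    (\<forall>i. d i \<longleftrightarrow> i \<in> {2..n} \<and> odd_prefix x (i - 1) \<and> \<not> x i) \<and>
    (\<forall>i. l i \<longleftrightarrow> i \<in> {1..n - 1} \<and> odd_prefix x i \<and> x (Suc i))" (is "_ \<longleftrightarrow> ?R")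
proof
  assume pc: "parity_chain n x r d l"
  have supp: "r i \<Longrightarrow> i \<in> {1..n}" "d i \<Longrightarrow> i \<in> {2..n}" "l i \<Longrightarrow> i \<in> {1..n - 1}" for i
    using pc unfolding parity_chain_def by blast+
  have outer: "of_bool (x (Suc i)) + of_bool (r (Suc i)) + of_bool (d (Suc i)) = (1::nat)"
    and inner: "of_bool (r (Suc i)) + of_bool (d (Suc (Suc i))) + of_bool (l (Suc i)) + of_bool (l i) = (1::nat)"
    if "i < n" for i
    using pc that unfolding parity_chain_def by (metis One_nat_def Suc_le_eq atLeastAtMost_iff diff_Suc_1 le_add1 plus_1_eq_Suc)+
  have step: "of_bool D' + of_bool L' = (of_bool (u \<noteq> X) :: nat)"
      "(R \<longleftrightarrow> \<not> u \<and> \<not> X) \<and> (D \<longleftrightarrow> u \<and> \<not> X) \<and> (L \<longleftrightarrow> u \<and> X)"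
    if "of_bool X + of_bool R + of_bool D = (1::nat)"
      "of_bool R + of_bool D' + of_bool L' + of_bool L = (1::nat)"
      "of_bool D + of_bool L = (of_bool u :: nat)" for X R D D' L L' u
    using that by (cases X; cases R; cases D; cases L; cases D'; cases L'; cases u; simp)+
  \<comment> \<open>the parity of \<open>x 1, \<dots>, x i\<close> is carried across by \<open>d (Suc i)\<close> or \<open>l i\<close>\<close>
  have carry: "of_bool (d (Suc i)) + of_bool (l i) = (of_bool (odd_prefix x i) :: nat)" if "i \<le> n" for i
    using that
  proof (induction i)
    case 0
    then show ?case using supp(2)[of 1] supp(3)[of 0] by auto
  next
    case (Suc i)
    then have "i < n" by simp
    moreover have "of_bool (d (Suc i)) + of_bool (l i) = (of_bool (odd_prefix x i) :: nat)"
      using Suc by simp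
    ultimately show ?case unfolding odd_prefix.simps using step outer inner by blast
  qed
  have "\<not> d (Suc n)" "\<not> l n" using supp(2)[of "Suc n"] supp(3)[of n] by auto
  then have fin: "\<not> odd_prefix x n" using carry[of n] by (auto split: if_splits)
  have vals: "(r (Suc i) \<longleftrightarrow> \<not> odd_prefix x i \<and> \<not> x (Suc i)) \<and>
      (d (Suc i) \<longleftrightarrow> odd_prefix x i \<and> \<not> x (Suc i)) \<and> (l i \<longleftrightarrow> odd_prefix x i \<and> x (Suc i))"
    if "i < n" for i
    using that by (intro step(2)[OF outer inner carry]) simp_all
  have "r i \<longleftrightarrow> i \<in> {1..n} \<and> \<not> odd_prefix x (i - 1) \<and> \<not> x i" for i
    using vals[of "i - 1"] supp(1)[of i] by (cases i) auto
  moreover have "d i \<longleftrightarrow> i \<in> {2..n} \<and> odd_prefix x (i - 1) \<and> \<not> x i" for i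
    using vals[of "i - 1"] supp(2)[of i] by (cases i) auto
  moreover have "l i \<longleftrightarrow> i \<in> {1..n - 1} \<and> odd_prefix x i \<and> x (Suc i)" for i
    using vals[of i] supp(3)[of i] by (cases "i < n"; cases i) auto
  ultimately show ?R using fin by blast
next
  assume R: ?R
  then have fin: "\<not> odd_prefix x n"
    and R': "r i \<longleftrightarrow> i \<in> {1..n} \<and> \<not> odd_prefix x (i - 1) \<and> \<not> x i"
      "d i \<longleftrightarrow> i \<in> {2..n} \<and> odd_prefix x (i - 1) \<and> \<not> x i"
      "l i \<longleftrightarrow> i \<in> {1..n - 1} \<and> odd_prefix x i \<and> x (Suc i)" for i
    by blast+
  have l: "l i \<longleftrightarrow> odd_prefix x i \<and> x (Suc i)" if "i < n" for i
    unfolding R'(3) using that by (cases i) auto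
  have d: "d (Suc i) \<longleftrightarrow> odd_prefix x i \<and> \<not> x (Suc i)" if "i < n" for i
    unfolding R'(2) using that by (cases i) auto
  have r: "r (Suc i) \<longleftrightarrow> \<not> odd_prefix x i \<and> \<not> x (Suc i)" if "i < n" for i
    unfolding R'(1) using that by auto
  have carry: "of_bool (d (Suc i)) + of_bool (l i) = (of_bool (odd_prefix x i) :: nat)" if "i \<le> n" for i
  proof (cases "i = n")
    case True
    then have "\<not> d (Suc i)" "\<not> l i" unfolding R' by auto
    then show ?thesis using fin True by simp
  next
    case False
    then have "i < n" using that by simp
    from l[OF this] d[OF this] show ?thesis by (cases "odd_prefix x i"; cases "x (Suc i)"; simp)
  qed
  have "of_bool (x (Suc i)) + of_bool (r (Suc i)) + of_bool (d (Suc i)) = (1::nat)" if "i < n" for i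
    unfolding d[OF that] r[OF that] by (cases "odd_prefix x i"; cases "x (Suc i)"; simp)
  moreover have "of_bool (r (Suc i)) + of_bool (d (Suc (Suc i))) + of_bool (l (Suc i)) + of_bool (l i) = (1::nat)"
    if "i < n" for i
    using carry[of "Suc i"] that unfolding r[OF that] l[OF that] odd_prefix.simps
    by (cases "odd_prefix x i"; cases "x (Suc i)"; simp)
  ultimately have "of_bool (x i) + of_bool (r i) + of_bool (d i) = (1::nat)"
    "of_bool (r i) + of_bool (d (Suc i)) + of_bool (l i) + of_bool (l (i - 1)) = (1::nat)" if "i \<in> {1..n}" for i
    using that by (cases i; simp)+
  then show "parity_chain n x r d l" unfolding parity_chain_def R' by blast
qed

section \<open>Even subconfigurations as sets of triangles\<close>

text \<open>
  A triangular configuration is generated by its triangles, because every simplex of a finite complex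
  lies in a maximal one.
\<close>

lemma even_subconfiguration_generated:
  assumes C: "even_subconfiguration \<Delta> C"
  shows "C = generated_cpx (triangles C)" "triangles C \<subseteq> triangles \<Delta>"
    "card e = 2 \<Longrightarrow> even (card {t \<in> triangles C. e \<subseteq> t})"
proof -
  have fin: "finite C" and simp: "simplicial_cpx C" and max: "\<And>s. maximal_simplex C s \<Longrightarrow> card s = 3"
    and sub: "C \<subseteq> \<Delta>" and ev: "\<And>e. e \<in> edges C \<Longrightarrow> even (card {t \<in> triangles C. e \<subseteq> t})"
    using C unfolding even_subconfiguration_def triangular_configuration_def by auto
  show "C = generated_cpx (triangles C)"
  proof (intro equalityI subsetI)
    fix s assume s: "s \<in> C"
    obtain u where u: "u \<in> C" "s \<subseteq> u" "\<forall>v\<in>C. u \<subseteq> v \<longrightarrow> u = v"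
      using finite_has_maximal2[OF fin s] by blast
    then have "u \<in> triangles C" using max[of u] unfolding maximal_simplex_def triangles_def by blast
    moreover have "s \<noteq> {}" using simp s unfolding simplicial_cpx_def by blast
    ultimately show "s \<in> generated_cpx (triangles C)" using u unfolding generated_cpx_def by blast
  next
    fix s assume "s \<in> generated_cpx (triangles C)"
    then show "s \<in> C" using simp unfolding generated_cpx_def triangles_def simplicial_cpx_def by blast
  qed
  show "triangles C \<subseteq> triangles \<Delta>" using sub unfolding triangles_def by blast
  assume card_e: "card e = 2"
  show "even (card {t \<in> triangles C. e \<subseteq> t})"
  proof (cases "e \<in> C")
    case True
    then show ?thesis using ev card_e unfolding edges_def by blast
  next
    case False
    have "e \<noteq> {}" using card_e by auto
    then have "{t \<in> triangles C. e \<subseteq> t} = {}"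
      using False simp unfolding triangles_def simplicial_cpx_def by blast
    then show ?thesis by (simp only: card.empty even_zero)
  qed
qed

lemma generated_even_subconfiguration:
  assumes \<Delta>: "triangular_configuration \<Delta>" and X: "X \<subseteq> triangles \<Delta>"
    and ev: "\<And>e. e \<in> edges \<Delta> \<Longrightarrow> even (card {t \<in> X. e \<subseteq> t})"
  shows "even_subconfiguration \<Delta> (generated_cpx X)" "triangles (generated_cpx X) = X"
proof -
  have card3: "\<forall>t\<in>X. card t = 3" using X unfolding triangles_def by blast
  have fin: "finite \<Delta>" and simp: "simplicial_cpx \<Delta>"
    using \<Delta> unfolding triangular_configuration_def by auto
  show tri: "triangles (generated_cpx X) = X" by (rule triangles_generated_cpx[OF card3])
  have sub: "generated_cpx X \<subseteq> \<Delta>"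
    using X simp unfolding generated_cpx_def triangles_def simplicial_cpx_def by blast
  have "simplicial_cpx (generated_cpx X)"
    unfolding simplicial_cpx_def
  proof (intro conjI ballI allI impI)
    fix s assume "s \<in> generated_cpx X"
    then show "finite s" using sub simp unfolding simplicial_cpx_def by blast
  next
    fix s assume "s \<in> generated_cpx X"
    then show "s \<noteq> {}" unfolding generated_cpx_def by blast
  next
    fix s u assume "s \<in> generated_cpx X" "u \<noteq> {} \<and> u \<subseteq> s"
    then show "u \<in> generated_cpx X" unfolding generated_cpx_def by blast
  qed
  moreover have "card s = 3" if s: "maximal_simplex (generated_cpx X) s" for s
  proof -
    obtain t where t: "t \<in> X" "s \<subseteq> t" using s unfolding maximal_simplex_def generated_cpx_def by blast
    then have "t \<in> generated_cpx X" using card3 unfolding generated_cpx_def by fastforce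
    then have "t = s" using s t unfolding maximal_simplex_def by blast
    then show ?thesis using card3 t by blast
  qed
  ultimately have "triangular_configuration (generated_cpx X)"
    unfolding triangular_configuration_def using sub fin finite_subset by blast
  moreover have "even (card {t \<in> X. e \<subseteq> t})" if "e \<in> edges (generated_cpx X)" for e
    using that sub ev unfolding edges_def by blast
  ultimately show "even_subconfiguration \<Delta> (generated_cpx X)"
    unfolding even_subconfiguration_def tri using sub by blast
qed

lemma ex1_three:
  assumes "distinct [a, b, c]"
  shows "(\<exists>!h. h \<in> A \<and> h \<in> {a, b, c}) \<longleftrightarrow> of_bool (a \<in> A) + of_bool (b \<in> A) + of_bool (c \<in> A) = (1::nat)"
  using assms by (cases "a \<in> A"; cases "b \<in> A"; cases "c \<in> A"; simp; blast)

lemma ex1_four: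
  assumes "distinct [a, b, c, d]"
  shows "(\<exists>!h. h \<in> A \<and> h \<in> {a, b, c, d}) \<longleftrightarrow>
    of_bool (a \<in> A) + of_bool (b \<in> A) + of_bool (c \<in> A) + of_bool (d \<in> A) = (1::nat)"
  using assms by (cases "a \<in> A"; cases "b \<in> A"; cases "c \<in> A"; cases "d \<in> A"; simp; blast)

section \<open>The matching reduction\<close>

definition links :: "nat \<Rightarrow> link set" where
  "links n = Rung ` {1..n} \<union> Diag ` {2..n} \<union> Rail ` {1..n - 1}"

locale reduction =
  fixes \<Delta> :: "'a set set"
    and eds inc :: "'a set \<Rightarrow> 'a set list"
    and tw :: "'a octcopy \<Rightarrow> nat \<Rightarrow> oct \<Rightarrow> corner"
  assumes config: "triangular_configuration \<Delta>"
    and choices: "reduction_choices \<Delta> eds inc tw"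
begin

definition copies :: "'a octcopy set" where
  "copies = TriCopy ` triangles \<Delta> \<union> (\<Union>e\<in>edges \<Delta>. EdgeCopy e ` links (length (inc e)))"

fun ends :: "'a octcopy \<Rightarrow> nat set" where
  "ends (TriCopy t) = {1, 3, 5}"
| "ends (EdgeCopy e l) = {1, 3}"

text \<open>
  The position of a label \<open>k \<in> {1, 3, 5}\<close> in the list of edges is \<open>(k - 1) div 2\<close>. Positions in
  configurations \<open>C\<close> count from 1, whereas lists are indexed from 0.
\<close>

fun hub :: "'a octcopy \<Rightarrow> nat \<Rightarrow> corner \<Rightarrow> 'a redvertex" where
  "hub (TriCopy t) k = Outer t (eds t ! ((k - 1) div 2))"
| "hub (EdgeCopy e (Rung i)) k = (if k = 1 then Outer (inc e ! (i - 1)) e else Inner (inc e ! (i - 1)) e)"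
| "hub (EdgeCopy e (Diag i)) k = (if k = 1 then Outer (inc e ! (i - 1)) e else Inner (inc e ! (i - 2)) e)"
| "hub (EdgeCopy e (Rail i)) k = (if k = 1 then Inner (inc e ! (i - 1)) e else Inner (inc e ! i) e)"

lemma hub_form: "\<exists>t e. hub g k = Outer t e \<or> hub g k = Inner t e"
  by (cases "(g, k)" rule: hub.cases) auto

lemma Outer_Inner_eq [simp]:
  "Outer t e = Outer t' e' \<longleftrightarrow> t = t' \<and> e = e'"
  "Inner t e = Inner t' e' \<longleftrightarrow> t = t' \<and> e = e'"
  "Outer t e \<noteq> Inner t' e'" "Inner t e \<noteq> Outer t' e'"
  by (auto simp: fun_eq_iff)

lemma triangle:
  assumes t: "t \<in> triangles \<Delta>"
  shows "distinct (eds t)" "set (eds t) = edges_of t" "length (eds t) = 3" "edges_of t \<subseteq> edges \<Delta>"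
proof -
  show dist: "distinct (eds t)" and set: "set (eds t) = edges_of t"
    using choices t unfolding reduction_choices_def by auto
  have card_t: "card t = 3" using t unfolding triangles_def by blast
  have "inj_on (\<lambda>x. t - {x}) t" by (rule inj_onI) blast
  then have "card (edges_of t) = 3"
    unfolding edges_of_triangle[OF card_t] using card_t by (simp add: card_image)
  then show "length (eds t) = 3" using distinct_card[OF dist] set by simp
  show "edges_of t \<subseteq> edges \<Delta>"
  proof
    fix e assume e: "e \<in> edges_of t"
    then have "e \<noteq> {}" unfolding edges_of_def by auto
    then show "e \<in> edges \<Delta>"
      using e t config
      unfolding edges_of_def edges_def triangles_def triangular_configuration_def simplicial_cpx_def
      by blast
  qed
qed

lemma edge:
  assumes "e \<in> edges \<Delta>"
  shows "distinct (inc e)" "set (inc e) = {t \<in> triangles \<Delta>. e \<subseteq> t}"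
  using choices assms unfolding reduction_choices_def by auto

lemma inc_eq_iff:
  assumes "e \<in> edges \<Delta>" "i < length (inc e)" "j < length (inc e)"
  shows "inc e ! i = inc e ! j \<longleftrightarrow> i = j"
  using nth_eq_iff_index_eq[OF edge(1)[OF assms(1)] assms(2,3)] .

lemma inc_pred_eq_iff:
  assumes "e \<in> edges \<Delta>" "i \<in> {1..length (inc e)}" "j \<in> {1..length (inc e)}"
  shows "inc e ! (i - 1) = inc e ! (j - 1) \<longleftrightarrow> i = j"
proof -
  have "i - 1 = j - 1 \<longleftrightarrow> i = j" using assms(2,3) by auto
  moreover have "i - 1 < length (inc e)" "j - 1 < length (inc e)" using assms(2,3) by auto
  ultimately show ?thesis using inc_eq_iff[OF assms(1)] by blast
qed

lemma copies_cases:
  assumes "g \<in> copies"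
  obtains (tri) t where "t \<in> triangles \<Delta>" "g = TriCopy t"
    | (rung) e i where "e \<in> edges \<Delta>" "1 \<le> i" "i \<le> length (inc e)" "g = EdgeCopy e (Rung i)"
    | (diag) e i where "e \<in> edges \<Delta>" "2 \<le> i" "i \<le> length (inc e)" "g = EdgeCopy e (Diag i)"
    | (rail) e i where "e \<in> edges \<Delta>" "1 \<le> i" "i < length (inc e)" "g = EdgeCopy e (Rail i)"
proof -
  have "g \<in> TriCopy ` triangles \<Delta> \<or> (\<exists>e\<in>edges \<Delta>. g \<in> EdgeCopy e ` links (length (inc e)))"
    using assms unfolding copies_def by simp
  then show thesis
  proof (elim disjE bexE imageE)
    fix e l assume *: "e \<in> edges \<Delta>" "g = EdgeCopy e l" "l \<in> links (length (inc e))"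
    from *(3) have "l \<in> Rung ` {1..length (inc e)} \<or> l \<in> Diag ` {2..length (inc e)} \<or> l \<in> Rail ` {1..length (inc e) - 1}"
      unfolding links_def by simp
    then show thesis
    proof (elim disjE imageE)
      fix i assume "l = Rail i" "i \<in> {1..length (inc e) - 1}"
      moreover from this have "1 \<le> i" "i < length (inc e)" by auto
      ultimately show thesis using rail[of e i] *(1,2) by simp
    qed (use rung diag *(1,2) in simp_all)
  qed (use tri in simp)
qed

lemma copies_iff:
  "TriCopy t \<in> copies \<longleftrightarrow> t \<in> triangles \<Delta>"
  "EdgeCopy e (Rung i) \<in> copies \<longleftrightarrow> e \<in> edges \<Delta> \<and> i \<in> {1..length (inc e)}"
  "EdgeCopy e (Diag i) \<in> copies \<longleftrightarrow> e \<in> edges \<Delta> \<and> i \<in> {2..length (inc e)}"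
  "EdgeCopy e (Rail i) \<in> copies \<longleftrightarrow> e \<in> edges \<Delta> \<and> i \<in> {1..length (inc e) - 1}"
proof -
  have "EdgeCopy e l \<in> copies \<longleftrightarrow> e \<in> edges \<Delta> \<and> l \<in> links (length (inc e))" for l
    unfolding copies_def by blast
  then show "EdgeCopy e (Rung i) \<in> copies \<longleftrightarrow> e \<in> edges \<Delta> \<and> i \<in> {1..length (inc e)}"
    "EdgeCopy e (Diag i) \<in> copies \<longleftrightarrow> e \<in> edges \<Delta> \<and> i \<in> {2..length (inc e)}"
    "EdgeCopy e (Rail i) \<in> copies \<longleftrightarrow> e \<in> edges \<Delta> \<and> i \<in> {1..length (inc e) - 1}"
    unfolding links_def by auto
qed (auto simp: copies_def)

sublocale gadget_complex copies Octa tw ends hub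
proof
  fix g h :: "'a octcopy" and k l :: nat and c d
  show "hub g k c = hub h l d \<longleftrightarrow> hub g k = hub h l \<and> c = d"
    using hub_form[of g k] hub_form[of h l] by auto
  show "Octa g x \<noteq> hub h k c" for x
    using hub_form[of h k] by auto
next
  fix g assume g: "g \<in> copies"
  show "ends g \<subseteq> {1, 3, 5}" by (cases g) auto
  show "inj_on (hub g) (ends g)" using g
  proof (cases rule: copies_cases)
    case (tri t)
    have "eds t ! i = eds t ! j \<longleftrightarrow> i = j" if "i < 3" "j < 3" for i j
      using nth_eq_iff_index_eq[OF triangle(1)[OF tri(1)]] triangle(3)[OF tri(1)] that by simp
    from this[of 0 1] this[of 0 2] this[of 1 2] show ?thesis using tri(2) by auto
  next
    case (rail e i)
    then show ?thesis using inc_eq_iff[of e "i - 1" i] by auto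
  qed auto
  show "bij_betw (tw g k) (tP k) UNIV" if "k \<in> ends g" for k
  proof -
    have "\<forall>k\<in>{1, 3, 5}. bij_betw (tw g k) (tP k) UNIV"
      using choices unfolding reduction_choices_def by simp
    moreover have "k \<in> {1, 3, 5}" using \<open>ends g \<subseteq> {1, 3, 5}\<close> that by (rule subsetD)
    ultimately show ?thesis by (rule bspec)
  qed
qed auto

lemma red_triangle_eq: "red_triangle eds tw t = gadget (Octa (TriCopy t)) (tw (TriCopy t)) (ends (TriCopy t)) (hub (TriCopy t))"
  unfolding red_triangle_def matching_triangle_def gadget_def matching_triangle_sides_def
  by (simp add: Un_assoc)

lemma matching_edge_eq: "matching_edge \<iota> \<tau> p q = gadget \<iota> \<tau> {1, 3} (\<lambda>k. if k = 1 then p else q)"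
  unfolding matching_edge_def gadget_def by simp

lemma red_parity_eq:
  "red_parity inc tw e = (\<Union>g\<in>EdgeCopy e ` links (length (inc e)).
     gadget (Octa g) (tw g) (ends g) (hub g))"
proof -
  have "hub (EdgeCopy e (Rung i)) = (\<lambda>k. if k = 1 then Outer (inc e ! (i - 1)) e else Inner (inc e ! (i - 1)) e)"
    "hub (EdgeCopy e (Diag i)) = (\<lambda>k. if k = 1 then Outer (inc e ! (i - 1)) e else Inner (inc e ! (i - 1 - 1)) e)"
    "hub (EdgeCopy e (Rail i)) = (\<lambda>k. if k = 1 then Inner (inc e ! (i - 1)) e else Inner (inc e ! (i + 1 - 1)) e)" for i
    by (auto simp: fun_eq_iff numeral_2_eq_2)
  then show ?thesis
    unfolding red_parity_def parity_configuration_def matching_edge_eq links_def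
    by (simp add: image_Un image_image UN_Un)
qed

lemma matching_reduction_eq:
  "matching_reduction \<Delta> eds inc tw = (\<Union>g\<in>copies. gadget (Octa g) (tw g) (ends g) (hub g))"
  unfolding matching_reduction_def red_triangle_eq red_parity_eq copies_def by blast

lemma perfect_matching_iff:
  "perfect_matching (matching_reduction \<Delta> eds inc tw) M \<longleftrightarrow> (\<exists>A. exact_hub_cover A \<and> M = select A)"
  unfolding matching_reduction_eq by (rule perfect_matching_iff_select)

lemma red_M_eq:
  assumes "t \<in> triangles \<Delta>"
  shows "red_M1 eds tw t = on (TriCopy t)" "red_M0 eds tw t = off (TriCopy t)"
proof -
  have t: "TriCopy t \<in> copies" using assms copies_iff by blast
  show "red_M1 eds tw t = on (TriCopy t)"
    unfolding red_M1_def using matching_triangle_eq(1)[OF t] by simp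
  show "red_M0 eds tw t = off (TriCopy t)"
    unfolding red_M0_def using matching_triangle_eq(2)[OF t] by simp
qed

lemma triangles_red_triangle:
  assumes "t \<in> triangles \<Delta>"
  shows "triangles (red_triangle eds tw t) = on (TriCopy t) \<union> off (TriCopy t)"
proof -
  have t: "TriCopy t \<in> copies" using assms copies_iff by blast
  then have "on (TriCopy t) \<union> off (TriCopy t) \<subseteq> tris" unfolding tris_def by blast
  then show ?thesis
    unfolding red_triangle_eq gadget_eq[OF t] using card_tris by (intro triangles_generated_cpx) blast
qed

text \<open>
  Since the two states of a matching triangle differ, prescribing the part of a matching in it means
  prescribing its state.
\<close>

lemma corresponding_matching_iff:
  "corresponding_matching \<Delta> eds inc tw C M \<longleftrightarrow>
    (\<exists>A. exact_hub_cover A \<and> M = select A \<and> (\<forall>t\<in>triangles \<Delta>. t \<in> C \<longleftrightarrow> TriCopy t \<in> A))"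
proof -
  define P where "P M \<longleftrightarrow> (\<forall>t\<in>triangles \<Delta>. M \<inter> triangles (red_triangle eds tw t) =
      (if t \<in> C then red_M1 eds tw t else red_M0 eds tw t))" for M
  define R where "R A \<longleftrightarrow> (\<forall>t\<in>triangles \<Delta>. t \<in> C \<longleftrightarrow> TriCopy t \<in> A)" for A
  have "P (select A) \<longleftrightarrow> R A" for A
    unfolding P_def R_def
  proof (rule ball_cong[OF refl])
    fix t assume t: "t \<in> triangles \<Delta>"
    have g: "TriCopy t \<in> copies" using t copies_iff by blast
    have "face (TriCopy t) 2 \<in> on (TriCopy t)" unfolding on_def by simp
    then have "on (TriCopy t) \<noteq> off (TriCopy t)" using on_off_disjoint[OF g] by blast
    then show "select A \<inter> triangles (red_triangle eds tw t) =
      (if t \<in> C then red_M1 eds tw t else red_M0 eds tw t) \<longleftrightarrow> (t \<in> C \<longleftrightarrow> TriCopy t \<in> A)"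
      unfolding triangles_red_triangle[OF t] red_M_eq[OF t] select_Int[OF g] by auto
  qed
  then show ?thesis
    unfolding corresponding_matching_def perfect_matching_iff P_def[symmetric] R_def[symmetric] by blast
qed

text \<open>
  Every hub belongs to the configuration of a single edge \<open>e\<close>, where it is the \<open>i\<close>-th empty triangle
  \<open>Outer\<close> or \<open>Inner\<close>, and both are used by \<open>Rung i\<close>. Listing the copies with a tunnel to it gives the
  two sums of a parity chain.
\<close>

lemma exact_hub_cover_iff_chains:
  "exact_hub_cover A \<longleftrightarrow> A \<subseteq> copies \<and> (\<forall>e\<in>edges \<Delta>. parity_chain (length (inc e))
     (\<lambda>i. TriCopy (inc e ! (i - 1)) \<in> A) (\<lambda>i. EdgeCopy e (Rung i) \<in> A)
     (\<lambda>i. EdgeCopy e (Diag i) \<in> A) (\<lambda>i. EdgeCopy e (Rail i) \<in> A))"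
proof (cases "A \<subseteq> copies")
  case False
  then show ?thesis unfolding exact_hub_cover_def by simp
next
  case A: True
  let ?unique = "\<lambda>s. \<exists>!h. h \<in> A \<and> s \<in> hub h ` ends h"
  have outer_hub: "Outer (inc e ! (i - 1)) e \<in> hub h ` ends h \<longleftrightarrow>
      h \<in> {TriCopy (inc e ! (i - 1)), EdgeCopy e (Rung i), EdgeCopy e (Diag i)}"
    if e: "e \<in> edges \<Delta>" "i \<in> {1..length (inc e)}" and h: "h \<in> copies" for e i h
    using h
  proof (cases rule: copies_cases)
    case (tri t)
    show ?thesis
    proof
      assume "Outer (inc e ! (i - 1)) e \<in> hub h ` ends h"
      then show "h \<in> {TriCopy (inc e ! (i - 1)), EdgeCopy e (Rung i), EdgeCopy e (Diag i)}"
        using tri by auto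
    next
      assume "h \<in> {TriCopy (inc e ! (i - 1)), EdgeCopy e (Rung i), EdgeCopy e (Diag i)}"
      then have t: "t = inc e ! (i - 1)" using tri by simp
      moreover have "i - 1 < length (inc e)" using e(2) by auto
      ultimately have "t \<in> set (inc e)" using nth_mem by simp
      then have "e \<in> edges_of t" using edge(2)[OF e(1)] e(1) unfolding edges_of_def edges_def by blast
      then obtain j where j: "j < 3" "e = eds t ! j"
        using triangle(2,3)[OF tri(1)] by (metis in_set_conv_nth)
      \<comment> \<open>the \<open>j\<close>-th edge of \<open>t\<close> is served by the label \<open>2 * j + 1\<close>\<close>
      then have "Outer t e = hub h (2 * j + 1)" "2 * j + 1 \<in> ends h"
        using tri(2) by auto
      then show "Outer (inc e ! (i - 1)) e \<in> hub h ` ends h" using t by blast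
    qed
  next
    case (rung f j)
    then show ?thesis using e inc_pred_eq_iff[of e i j] by auto
  next
    case (diag f j)
    then show ?thesis using e inc_pred_eq_iff[of e i j] by auto
  next
    case (rail f j)
    then show ?thesis by auto
  qed
  have inner_hub: "Inner (inc e ! (i - 1)) e \<in> hub h ` ends h \<longleftrightarrow>
      h \<in> {EdgeCopy e (Rung i), EdgeCopy e (Diag (Suc i)), EdgeCopy e (Rail i), EdgeCopy e (Rail (i - 1))}"
    if e: "e \<in> edges \<Delta>" "i \<in> {1..length (inc e)}" and h: "h \<in> copies" for e i h
    using h
  proof (cases rule: copies_cases)
    case (tri t)
    then show ?thesis by auto
  next
    case (rung f j)
    then show ?thesis using e inc_pred_eq_iff[of e i j] by auto
  next
    case (diag f j)
    then obtain m where "j = Suc m" "1 \<le> m" by (cases j) auto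
    then show ?thesis using diag e inc_pred_eq_iff[of e i m] by (auto simp: numeral_2_eq_2)
  next
    case (rail f j)
    then show ?thesis using e inc_pred_eq_iff[of e i j] inc_pred_eq_iff[of e i "Suc j"] by auto
  qed
  have hubs: "(\<forall>g\<in>copies. \<forall>k\<in>ends g. ?unique (hub g k)) \<longleftrightarrow>
    (\<forall>e\<in>edges \<Delta>. \<forall>i\<in>{1..length (inc e)}.
       ?unique (Outer (inc e ! (i - 1)) e) \<and> ?unique (Inner (inc e ! (i - 1)) e))"
    (is "?L \<longleftrightarrow> ?R")
  proof
    assume L: ?L
    show ?R
    proof (intro ballI)
      fix e i assume "e \<in> edges \<Delta>" "i \<in> {1..length (inc e)}"
      then have "EdgeCopy e (Rung i) \<in> copies" using copies_iff(2) by blast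
      with L have "\<forall>k\<in>ends (EdgeCopy e (Rung i)). ?unique (hub (EdgeCopy e (Rung i)) k)"
        by (rule bspec)
      from bspec[OF this, of 1] bspec[OF this, of 3]
      show "?unique (Outer (inc e ! (i - 1)) e) \<and> ?unique (Inner (inc e ! (i - 1)) e)" by simp
    qed
  next
    assume R: ?R
    then have O: "?unique (Outer (inc e ! j) e)" and I: "?unique (Inner (inc e ! j) e)"
      if "e \<in> edges \<Delta>" "j < length (inc e)" for e j
      using bspec[OF bspec[OF R that(1)], of "Suc j"] that(2) by auto
    show ?L
    proof (intro ballI)
      fix g k assume g: "g \<in> copies" "k \<in> ends g"
      from g(1) show "?unique (hub g k)"
      proof (cases rule: copies_cases)
        case (tri t)
        let ?e = "eds t ! ((k - 1) div 2)"
        have "(k - 1) div 2 < length (eds t)" using g(2) tri triangle(3) by auto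
        then have "?e \<in> edges_of t" using triangle(2)[OF tri(1)] nth_mem by metis
        then have e: "?e \<in> edges \<Delta>" "?e \<subseteq> t" using triangle(4)[OF tri(1)] unfolding edges_of_def by auto
        then have "t \<in> set (inc ?e)" using edge(2)[OF e(1)] tri(1) by blast
        then obtain j where "j < length (inc ?e)" "t = inc ?e ! j" by (metis in_set_conv_nth)
        then show ?thesis using O[OF e(1), of j] tri(2) by simp
      next
        case (rung e i)
        then show ?thesis using O[of e "i - 1"] I[of e "i - 1"] by simp
      next
        case (diag e i)
        then show ?thesis using O[of e "i - 1"] I[of e "i - 2"] by simp
      next
        case (rail e i)
        then show ?thesis using I[of e "i - 1"] I[of e i] by simp
      qed
    qed
  qed
  have outer: "?unique (Outer (inc e ! (i - 1)) e) \<longleftrightarrow>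
      of_bool (TriCopy (inc e ! (i - 1)) \<in> A) + of_bool (EdgeCopy e (Rung i) \<in> A) +
      of_bool (EdgeCopy e (Diag i) \<in> A) = (1::nat)"
    if "e \<in> edges \<Delta>" "i \<in> {1..length (inc e)}" for e i
  proof -
    have "h \<in> A \<and> Outer (inc e ! (i - 1)) e \<in> hub h ` ends h \<longleftrightarrow>
      h \<in> A \<and> h \<in> {TriCopy (inc e ! (i - 1)), EdgeCopy e (Rung i), EdgeCopy e (Diag i)}" for h
      using outer_hub[OF that] A by blast
    note eq = this
    show ?thesis unfolding eq by (rule ex1_three) simp
  qed
  have inner: "?unique (Inner (inc e ! (i - 1)) e) \<longleftrightarrow>
      of_bool (EdgeCopy e (Rung i) \<in> A) + of_bool (EdgeCopy e (Diag (Suc i)) \<in> A) +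
      of_bool (EdgeCopy e (Rail i) \<in> A) + of_bool (EdgeCopy e (Rail (i - 1)) \<in> A) = (1::nat)"
    if "e \<in> edges \<Delta>" "i \<in> {1..length (inc e)}" for e i
  proof -
    have "h \<in> A \<and> Inner (inc e ! (i - 1)) e \<in> hub h ` ends h \<longleftrightarrow>
      h \<in> A \<and> h \<in> {EdgeCopy e (Rung i), EdgeCopy e (Diag (Suc i)), EdgeCopy e (Rail i), EdgeCopy e (Rail (i - 1))}" for h
      using inner_hub[OF that] A by blast
    note eq = this
    have "distinct [EdgeCopy e (Rung i), EdgeCopy e (Diag (Suc i)), EdgeCopy e (Rail i), EdgeCopy e (Rail (i - 1))]"
      using that by auto
    then show ?thesis unfolding eq by (rule ex1_four)
  qed
  have supp: "\<forall>i. EdgeCopy e (Rung i) \<in> A \<longrightarrow> i \<in> {1..length (inc e)}"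
     "\<forall>i. EdgeCopy e (Diag i) \<in> A \<longrightarrow> i \<in> {2..length (inc e)}"
     "\<forall>i. EdgeCopy e (Rail i) \<in> A \<longrightarrow> i \<in> {1..length (inc e) - 1}" for e
    using A copies_iff by blast+
  have "(\<forall>i\<in>{1..length (inc e)}.
       ?unique (Outer (inc e ! (i - 1)) e) \<and> ?unique (Inner (inc e ! (i - 1)) e)) \<longleftrightarrow>
    parity_chain (length (inc e))
     (\<lambda>i. TriCopy (inc e ! (i - 1)) \<in> A) (\<lambda>i. EdgeCopy e (Rung i) \<in> A)
     (\<lambda>i. EdgeCopy e (Diag i) \<in> A) (\<lambda>i. EdgeCopy e (Rail i) \<in> A)" if e: "e \<in> edges \<Delta>" for e
    unfolding parity_chain_def supp[THEN eqTrueI] simp_thms ball_conj_distrib[symmetric]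
    by (rule ball_cong[OF refl]) (simp only: outer[OF e] inner[OF e])
  then have "?R \<longleftrightarrow> (\<forall>e\<in>edges \<Delta>. parity_chain (length (inc e))
     (\<lambda>i. TriCopy (inc e ! (i - 1)) \<in> A) (\<lambda>i. EdgeCopy e (Rung i) \<in> A)
     (\<lambda>i. EdgeCopy e (Diag i) \<in> A) (\<lambda>i. EdgeCopy e (Rail i) \<in> A))"
    by (rule ball_cong[OF refl])
  with hubs show ?thesis
    unfolding exact_hub_cover_def using A by (simp only: simp_thms)
qed

lemma odd_prefix_incident:
  assumes e: "e \<in> edges \<Delta>"
  shows "odd_prefix (\<lambda>i. inc e ! (i - 1) \<in> X) (length (inc e)) \<longleftrightarrow>
    odd (card {t \<in> triangles \<Delta>. t \<in> X \<and> e \<subseteq> t})"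
proof -
  let ?I = "{i \<in> {1..length (inc e)}. inc e ! (i - 1) \<in> X}"
  have "inj_on (\<lambda>i. inc e ! (i - 1)) ?I"
  proof (rule inj_onI)
    fix i j assume "i \<in> ?I" "j \<in> ?I" "inc e ! (i - 1) = inc e ! (j - 1)"
    then show "i = j" using inc_pred_eq_iff[OF e] by blast
  qed
  then have "card ?I = card ((\<lambda>i. inc e ! (i - 1)) ` ?I)" by (simp add: card_image)
  also have "(\<lambda>i. inc e ! (i - 1)) ` ?I = {t \<in> set (inc e). t \<in> X}"
  proof (intro equalityI subsetI)
    fix t assume "t \<in> {t \<in> set (inc e). t \<in> X}"
    then obtain j where "j < length (inc e)" "t = inc e ! j" "t \<in> X" by (auto simp: in_set_conv_nth)
    then have "Suc j \<in> ?I" "t = inc e ! (Suc j - 1)" by auto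
    then show "t \<in> (\<lambda>i. inc e ! (i - 1)) ` ?I" by blast
  qed auto
  also have "\<dots> = {t \<in> triangles \<Delta>. t \<in> X \<and> e \<subseteq> t}" unfolding edge(2)[OF e] by blast
  finally show ?thesis unfolding odd_prefix_iff_card by simp
qed

lemma exact_hub_cover_even:
  assumes "exact_hub_cover A" "e \<in> edges \<Delta>"
  shows "even (card {t \<in> triangles \<Delta>. TriCopy t \<in> A \<and> e \<subseteq> t})"
proof -
  have "\<not> odd_prefix (\<lambda>i. TriCopy (inc e ! (i - 1)) \<in> A) (length (inc e))"
    using assms unfolding exact_hub_cover_iff_chains parity_chain_iff by blast
  then show ?thesis using odd_prefix_incident[OF assms(2), of "{t. TriCopy t \<in> A}"] by simp
qed

lemma exact_hub_cover_determined:
  assumes "exact_hub_cover A" "exact_hub_cover B" "\<And>t. t \<in> triangles \<Delta> \<Longrightarrow> TriCopy t \<in> A \<longleftrightarrow> TriCopy t \<in> B"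
  shows "A = B"
proof -
  have AB: "A \<subseteq> copies" "B \<subseteq> copies" using assms(1,2) unfolding exact_hub_cover_def by auto
  have tri: "TriCopy t \<in> A \<longleftrightarrow> TriCopy t \<in> B" for t
    using assms(3) AB copies_iff(1) by blast
  have "EdgeCopy e l \<in> A \<longleftrightarrow> EdgeCopy e l \<in> B" if "e \<in> edges \<Delta>" for e l
    using assms(1,2) that unfolding exact_hub_cover_iff_chains parity_chain_iff tri by (cases l) simp_all
  then have "g \<in> A \<longleftrightarrow> g \<in> B" if "g \<in> copies" for g
    using that tri unfolding copies_def by blast
  then show ?thesis using AB by blast
qed

text \<open>
  The states of the links are read off from the solution of the parity chains.
\<close>

lemma exact_hub_cover_exists:
  assumes X: "X \<subseteq> triangles \<Delta>" "\<And>e. e \<in> edges \<Delta> \<Longrightarrow> even (card {t \<in> X. e \<subseteq> t})"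
  obtains A where "exact_hub_cover A" "\<And>t. TriCopy t \<in> A \<longleftrightarrow> t \<in> X"
proof
  define x where "x e i \<longleftrightarrow> inc e ! (i - 1) \<in> X" for e i
  define A where "A = {g \<in> copies. case g of TriCopy t \<Rightarrow> t \<in> X
    | EdgeCopy e (Rung i) \<Rightarrow> \<not> odd_prefix (x e) (i - 1) \<and> \<not> x e i
    | EdgeCopy e (Diag i) \<Rightarrow> odd_prefix (x e) (i - 1) \<and> \<not> x e i
    | EdgeCopy e (Rail i) \<Rightarrow> odd_prefix (x e) i \<and> x e (Suc i)}"
  show tri: "TriCopy t \<in> A \<longleftrightarrow> t \<in> X" for t
    using X(1) unfolding A_def by (auto simp: copies_iff)
  have "\<not> odd_prefix (x e) (length (inc e))" if "e \<in> edges \<Delta>" for e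
  proof -
    have "{t \<in> triangles \<Delta>. t \<in> X \<and> e \<subseteq> t} = {t \<in> X. e \<subseteq> t}" using X(1) by blast
    then show ?thesis using odd_prefix_incident[OF that, of X] X(2)[OF that] unfolding x_def by simp
  qed
  then show "exact_hub_cover A"
    unfolding exact_hub_cover_iff_chains parity_chain_iff tri x_def[symmetric] by (auto simp: A_def copies_iff)
qed

lemma even_subconfiguration_matching:
  assumes C: "even_subconfiguration \<Delta> C"
  shows "\<exists>!M. corresponding_matching \<Delta> eds inc tw C M"
proof -
  note gen = even_subconfiguration_generated[OF C]
  have "even (card {t \<in> triangles C. e \<subseteq> t})" if "e \<in> edges \<Delta>" for e
    using gen(3) that unfolding edges_def by blast
  then obtain A where A: "exact_hub_cover A" "\<And>t. TriCopy t \<in> A \<longleftrightarrow> t \<in> triangles C"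
    using exact_hub_cover_exists[OF gen(2)] by blast
  have "t \<in> C \<longleftrightarrow> TriCopy t \<in> A" if "t \<in> triangles \<Delta>" for t
    using that unfolding A(2) triangles_def by blast
  then show ?thesis
    unfolding corresponding_matching_iff using A(1) exact_hub_cover_determined by metis
qed

lemma corresponding_inj:
  assumes "even_subconfiguration \<Delta> C" "even_subconfiguration \<Delta> D"
    and "corresponding_matching \<Delta> eds inc tw C M" "corresponding_matching \<Delta> eds inc tw D M"
  shows "C = D"
proof -
  note C = even_subconfiguration_generated[OF assms(1)]
  note D = even_subconfiguration_generated[OF assms(2)]
  obtain A where A: "exact_hub_cover A" "M = select A" "\<forall>t\<in>triangles \<Delta>. t \<in> C \<longleftrightarrow> TriCopy t \<in> A"
    using assms(3) unfolding corresponding_matching_iff by blast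
  obtain B where B: "exact_hub_cover B" "M = select B" "\<forall>t\<in>triangles \<Delta>. t \<in> D \<longleftrightarrow> TriCopy t \<in> B"
    using assms(4) unfolding corresponding_matching_iff by blast
  have "TriCopy t \<in> A \<longleftrightarrow> TriCopy t \<in> B" if "t \<in> triangles \<Delta>" for t
  proof -
    have "TriCopy t \<in> copies" using that copies_iff by blast
    moreover have "face (TriCopy t) 2 \<in> on (TriCopy t)" unfolding on_def by simp
    ultimately show ?thesis using mem_select(1) A(2) B(2) by metis
  qed
  then have "t \<in> C \<longleftrightarrow> t \<in> D" if "t \<in> triangles \<Delta>" for t using A(3) B(3) that by blast
  then have "triangles C = triangles D" using C(2) D(2) unfolding triangles_def by blast
  then show ?thesis using C(1) D(1) by simp
qed

text \<open>
  The triangles whose matching triangle is in state \<open>on\<close> meet every edge in an even number, so they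
  generate an even subconfiguration.
\<close>

lemma corresponding_surj:
  assumes M: "perfect_matching (matching_reduction \<Delta> eds inc tw) M"
  obtains C where "even_subconfiguration \<Delta> C" "corresponding_matching \<Delta> eds inc tw C M"
proof -
  obtain A where A: "exact_hub_cover A" "M = select A" using M unfolding perfect_matching_iff by blast
  define X where "X = {t \<in> triangles \<Delta>. TriCopy t \<in> A}"
  have X: "X \<subseteq> triangles \<Delta>" unfolding X_def by blast
  have "{t \<in> X. e \<subseteq> t} = {t \<in> triangles \<Delta>. TriCopy t \<in> A \<and> e \<subseteq> t}" for e
    unfolding X_def by blast
  then have ev: "even (card {t \<in> X. e \<subseteq> t})" if "e \<in> edges \<Delta>" for e
    using exact_hub_cover_even[OF A(1) that] by simp
  then have gen: "even_subconfiguration \<Delta> (generated_cpx X)" "triangles (generated_cpx X) = X"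
    using generated_even_subconfiguration[OF config X] by blast+
  have "t \<in> generated_cpx X \<longleftrightarrow> TriCopy t \<in> A" if "t \<in> triangles \<Delta>" for t
  proof -
    have "t \<in> generated_cpx X \<longleftrightarrow> t \<in> triangles (generated_cpx X)"
      using that unfolding triangles_def by blast
    also have "\<dots> \<longleftrightarrow> t \<in> X" unfolding gen(2) ..
    finally show ?thesis using that unfolding X_def by simp
  qed
  then have "corresponding_matching \<Delta> eds inc tw (generated_cpx X) M"
    unfolding corresponding_matching_iff using A by blast
  then show thesis using that gen(1) by blast
qed

end

theorem theorem18:
  fixes \<Delta> :: "'a set set"
    and eds inc :: "'a set \<Rightarrow> 'a set list"
    and tw :: "'a octcopy \<Rightarrow> nat \<Rightarrow> oct \<Rightarrow> corner"
  assumes "triangular_configuration \<Delta>"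
    and "reduction_choices \<Delta> eds inc tw"
  shows "(\<forall>C. even_subconfiguration \<Delta> C \<longrightarrow> (\<exists>!M. corresponding_matching \<Delta> eds inc tw C M)) \<and>
    bij_betw (\<lambda>C. THE M. corresponding_matching \<Delta> eds inc tw C M)
      {C. even_subconfiguration \<Delta> C}
      {M. perfect_matching (matching_reduction \<Delta> eds inc tw) M}"
proof -
  interpret reduction \<Delta> eds inc tw using assms by (rule reduction.intro)
  let ?m = "\<lambda>C. THE M. corresponding_matching \<Delta> eds inc tw C M"
  have m: "corresponding_matching \<Delta> eds inc tw C (?m C)" if "even_subconfiguration \<Delta> C" for C
    using even_subconfiguration_matching[OF that] by (rule theI')
  have m_eq: "?m C = M" if "even_subconfiguration \<Delta> C" "corresponding_matching \<Delta> eds inc tw C M" for C M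
    using even_subconfiguration_matching[OF that(1)] that(2) by (rule the1_equality)
  have inj: "inj_on ?m {C. even_subconfiguration \<Delta> C}"
  proof (rule inj_onI)
    fix C D assume "C \<in> {C. even_subconfiguration \<Delta> C}" "D \<in> {C. even_subconfiguration \<Delta> C}"
      and eq: "?m C = ?m D"
    then have CD: "even_subconfiguration \<Delta> C" "even_subconfiguration \<Delta> D" by simp_all
    have "corresponding_matching \<Delta> eds inc tw D (?m C)" unfolding eq using CD(2) by (rule m)
    then show "C = D" using corresponding_inj[OF CD m[OF CD(1)]] by blast
  qed
  have "?m ` {C. even_subconfiguration \<Delta> C} =
      {M. perfect_matching (matching_reduction \<Delta> eds inc tw) M}"
  proof (intro equalityI subsetI)
    fix M assume "M \<in> ?m ` {C. even_subconfiguration \<Delta> C}"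
    then show "M \<in> {M. perfect_matching (matching_reduction \<Delta> eds inc tw) M}"
      using m unfolding corresponding_matching_def by auto
  next
    fix M assume "M \<in> {M. perfect_matching (matching_reduction \<Delta> eds inc tw) M}"
    then obtain C where "even_subconfiguration \<Delta> C" "corresponding_matching \<Delta> eds inc tw C M"
      using corresponding_surj by blast
    then show "M \<in> ?m ` {C. even_subconfiguration \<Delta> C}" using m_eq by blast
  qed
  with inj have "bij_betw ?m {C. even_subconfiguration \<Delta> C}
      {M. perfect_matching (matching_reduction \<Delta> eds inc tw) M}"
    by (rule bij_betw_imageI)
  then show ?thesis using even_subconfiguration_matching by blast
qed

end
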